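(* The double-forced multiparticle system $$\dot x=f(x)+g^u(x)u+g^v(x)v,\qquad (u,v)\in\mathbb{R}^2,\qquad g^u=\frac{\partial}{\partial p_1},\ g^v=\frac{\partial}{\partial p_n},$$ on $\mathbb{R}^{2n}$ is globally controllable, i.e. $\mathcal{A}_{\tilde x}=\mathbb{R}^{2n}$ for every $\tilde x\in\mathbb{R}^{2n}$.
   Context: Let $n\ge 2$. $\Phi:\mathbb{R}\to\mathbb{R}$ is a real analytic, bounded below function with $\lim_{y\to+\infty}\Phi(y)=+\infty$, and $\phi=\Phi'$. The state is $x=(q,p)=(q_1,\dots,q_n,p_1,\dots,p_n)\in\mathbb{R}^{2n}$. The drift is the vector field $$f=\sum_{k=1}^{n}p_k\frac{\partial}{\partial q_k}-\phi(q_1-q_2)\frac{\partial}{\partial p_1}+\sum_{k=2}^{n-1}\bigl(\phi(q_{k-1}-q_k)-\phi(q_k-q_{k+1})\bigr)\frac{\partial}{\partial p_k}+\phi(q_{n-1}-q_n)\frac{\partial}{\partial p_n}.$$ For a constant control value $c=(c^u,c^v)\in\mathbb{R}^2$ let $f^{c}=f+c^ug^u+c^vg^v$, with flow $e^{tf^c}$. The attainable set $\mathcal{A}_{\tilde x}$ is the set of all points $e^{t_1f^{c_1}}\circ\cdots\circ e^{t_Nf^{c_N}}(\tilde x)$ with $N\ge1$, $c_j\in\mathbb{R}^2$ and $t_j\ge0$. *)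

theory Defs
  imports "HOL-Analysis.Analysis"
begin

definition real_analytic :: "(real \<Rightarrow> real) \<Rightarrow> bool" where
  "real_analytic \<Phi> \<longleftrightarrow> (\<forall>y. \<exists>F. (\<lambda>h. \<Phi> (y + h)) has_fps_expansion F)"


section \<open>Flows and attainable sets of control systems\<close>

text \<open>\<open>flow_maps X t x y\<close> is the graph of the flow of the vector field \<open>X\<close>:
  the integral curve of \<open>X\<close> starting at \<open>x\<close> exists up to time \<open>t \<ge> 0\<close>
  and is at \<open>y\<close> then, i.e. $e^{tX}(x) = y$. It is a relation because the flow of a general
  field is neither total nor single-valued; for locally Lipschitz \<open>X\<close> there is at most
  one such \<open>y\<close>.\<close>

definition flow_maps :: "('a::real_normed_vector \<Rightarrow> 'a) \<Rightarrow> real \<Rightarrow> 'a \<Rightarrow> 'a \<Rightarrow> bool" where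
  "flow_maps X t x y \<longleftrightarrow>
     (\<exists>\<gamma>. \<gamma> 0 = x \<and> \<gamma> t = y \<and>
          (\<forall>s\<in>{0..t}. (\<gamma> has_vector_derivative X (\<gamma> s)) (at s within {0..t})))"

text \<open>\<open>F c\<close> is the vector field for the constant control value \<open>c\<close>. The points \<open>z j\<close> are
  the intermediate points of the composition
  $e^{t_1 F_{c_1}} \circ \cdots \circ e^{t_N F_{c_N}}$, in which the \<open>N\<close>-th flow acts first.\<close>

definition attainable :: "('c \<Rightarrow> 'a::real_normed_vector \<Rightarrow> 'a) \<Rightarrow> 'a \<Rightarrow> 'a set" where
  "attainable F x =
     {y. \<exists>N\<ge>1. \<exists>(c :: nat \<Rightarrow> 'c) (t :: nat \<Rightarrow> real) (z :: nat \<Rightarrow> 'a).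
           z N = x \<and> z 0 = y \<and>
           (\<forall>j\<in>{1..N}. t j \<ge> 0 \<and> flow_maps (F (c j)) (t j) (z j) (z (j - 1)))}"

definition globally_controllable :: "('c \<Rightarrow> 'a::real_normed_vector \<Rightarrow> 'a) \<Rightarrow> bool" where
  "globally_controllable F \<longleftrightarrow> (\<forall>x. attainable F x = UNIV)"


section \<open>The double-forced chain of particles\<close>

text \<open>The \<open>n\<close> particles are indexed by a finite linearly ordered type with \<open>n\<close> elements,
  and \<open>particle k\<close> is its \<open>k\<close>-th smallest element, for \<open>1 \<le> k \<le> n\<close>.
  A state is a pair \<open>(q, p)\<close>.\<close>

type_synonym 'n state = "(real ^ 'n) \<times> (real ^ 'n)"

definition particle :: "nat \<Rightarrow> 'n::{finite,linorder}" where
  "particle k = sorted_list_of_set (UNIV :: 'n set) ! (k - 1)"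

lemma bij_betw_particle:
  "bij_betw (particle :: nat \<Rightarrow> 'n::{finite,linorder}) {1..CARD('n)} UNIV"
proof -
  let ?xs = "sorted_list_of_set (UNIV :: 'n set)"
  have "bij_betw ((!) ?xs) {..<CARD('n)} UNIV"
    by (rule bij_betw_nth) auto
  moreover have "bij_betw (\<lambda>k. k - 1) {1..CARD('n)} {..<CARD('n)}"
    by (rule bij_betw_byWitness[where f' = Suc]) auto
  ultimately have "bij_betw ((!) ?xs \<circ> (\<lambda>k. k - 1)) {1..CARD('n)} UNIV"
    by (rule bij_betw_trans[rotated])
  then show ?thesis
    by (simp add: particle_def [abs_def] comp_def)
qed

definition q_coord :: "'n::{finite,linorder} state \<Rightarrow> nat \<Rightarrow> real" where
  "q_coord x k = fst x $ particle k"

definition p_coord :: "'n::{finite,linorder} state \<Rightarrow> nat \<Rightarrow> real" where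
  "p_coord x k = snd x $ particle k"

text \<open>The constant coordinate vector fields $\partial/\partial q_k$ and $\partial/\partial p_k$.\<close>

definition d_dq :: "nat \<Rightarrow> 'n::{finite,linorder} state" where
  "d_dq k = (axis (particle k) 1, 0)"

definition d_dp :: "nat \<Rightarrow> 'n::{finite,linorder} state" where
  "d_dp k = (0, axis (particle k) 1)"

definition drift ::
    "(real \<Rightarrow> real) \<Rightarrow> 'n::{finite,linorder} state \<Rightarrow> 'n state" where
  "drift \<phi> x =
     (let n = CARD('n); q = q_coord x; p = p_coord x in
        (\<Sum>k=1..n. p k *\<^sub>R d_dq k)
        - \<phi> (q 1 - q 2) *\<^sub>R d_dp 1
        + (\<Sum>k=2..n-1. (\<phi> (q (k - 1) - q k) - \<phi> (q k - q (k + 1))) *\<^sub>R d_dp k)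
        + \<phi> (q (n - 1) - q n) *\<^sub>R d_dp n)"

definition double_forced ::
    "(real \<Rightarrow> real) \<Rightarrow> real \<times> real \<Rightarrow> 'n::{finite,linorder} state \<Rightarrow> 'n state" where
  "double_forced \<phi> c x =
     drift \<phi> x + fst c *\<^sub>R d_dp 1 + snd c *\<^sub>R d_dp CARD('n)"

end

theory Submission
  imports Defs "HOL-Complex_Analysis.Cauchy_Integral_Formula"
begin

text \<open>Add to the energy of the chain two springs that tie the end particles to fixed points. The result is
  proper, so it attains its minimum over the closed set of states that can be approximately reached
  from a given one. In a minimiser the end particles cannot move under the constant controls that
  balance the springs, and by analyticity no other particle can: the minimiser is an equilibrium in
  which all bonds carry the same force \<open>u\<close>. For all but countably many positions of the springs,
  \<open>\<phi>'\<close> does not vanish on the bonds, so that the linearisation is controllable and the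
  equilibrium is reached exactly, from a whole neighbourhood of the initial state.

  Reversing the momenta turns trajectories into trajectories run backwards. Hence reachability is
  symmetric on the connected set of states at rest, where its classes are open, so all of
  these states are mutually reachable. Any state can be steered to a state at rest and, by reversal,
  can be reached from one.\<close>

section \<open>Real analytic functions of one variable\<close>

text \<open>The mechanical energy of the chain is not proper: it is invariant under translations,
  and \<open>\<Phi>\<close> may stay bounded at -infinity, so particles can fly apart and no
  recurrence is at hand. The springs repair this, but they only define a test function and exert no
  force in the system. A feedback imitating them would conserve the augmented energy; a constant
  control, balancing them at one state only, violates conservation to second order in the
  displacement of the end particles, and minimality absorbs this error. The minimum needs a closed
  set, hence approximate reachability, which is made uniform in the initial point so that it later
  yields whole neighbourhoods. The passage to exact reachability rests on local controllability, and
  a bond with vanishing \<open>\<phi>'\<close> would cut the linearised chain in two. Analyticity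
  enters as countability, twice: countable levels of \<open>\<phi>\<close> prevent a bond of
  constant force from changing its length, and countably many zeros of \<open>\<phi>'\<close> leave
  room for a choice of springs that avoids them.\<close>

lemma real_analytic_deriv:
  assumes "real_analytic f" and der: "\<And>y. (f has_real_derivative g y) (at y)"
  shows "real_analytic g"
  unfolding real_analytic_def
proof
  fix y
  obtain F where F: "(\<lambda>h. f (y + h)) has_fps_expansion F"
    using assms unfolding real_analytic_def by blast
  then have pos: "fps_conv_radius F > 0"
    and ev: "eventually (\<lambda>h. eval_fps F h = f (y + h)) (nhds 0)"
    by (auto simp: has_fps_expansion_def)
  have "eventually (\<lambda>h. h \<in> eball 0 (fps_conv_radius F)) (nhds (0::real))"
    using pos by (intro eventually_nhds_in_open) (auto simp: zero_ereal_def)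
  \<comment> \<open>Comparing derivatives at \<open>h\<close> takes agreement on a neighbourhood of
    \<open>h\<close>, not only at \<open>h\<close>.\<close>
  moreover have "eventually (\<lambda>h. eventually (\<lambda>h. eval_fps F h = f (y + h)) (nhds h)) (nhds 0)"
    using ev by (simp add: eventually_eventually)
  ultimately have "eventually (\<lambda>h. eval_fps (fps_deriv F) h = g (y + h)) (nhds 0)"
  proof eventually_elim
    case (elim h)
    have "(eval_fps F has_field_derivative eval_fps (fps_deriv F) h) (at h)"
      using elim(1) by (intro has_field_derivative_eval_fps) (simp add: in_eball_iff)
    moreover have "((\<lambda>h. f (y + h)) has_field_derivative g (y + h)) (at h)"
      using DERIV_shift[of f "g (y + h)" h y] der[of "y + h"] by (simp add: add.commute)
    then have "(eval_fps F has_field_derivative g (y + h)) (at h)"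
      using DERIV_cong_ev[OF refl elim(2) refl] by blast
    ultimately show ?case
      by (rule DERIV_unique)
  qed
  moreover have "fps_conv_radius (fps_deriv F) > 0"
    using pos fps_conv_radius_deriv[of F] by order
  ultimately show "\<exists>F. (\<lambda>h. g (y + h)) has_fps_expansion F"
    by (auto simp: has_fps_expansion_def)
qed

lemma real_analytic_diff_const:
  assumes "real_analytic f"
  shows "real_analytic (\<lambda>y. f y - c)"
  unfolding real_analytic_def
proof
  fix y
  obtain F where "(\<lambda>h. f (y + h)) has_fps_expansion F"
    using assms unfolding real_analytic_def by blast
  then show "\<exists>F. (\<lambda>h. f (y + h) - c) has_fps_expansion F"
    by (intro exI) (rule has_fps_expansion_diff[OF _ has_fps_expansion_const])
qed

text \<open>If \<open>f y = 0\<close>, the constant coefficient vanishes, so some coefficient of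
  positive index does not, as \<open>powser_0_nonzero\<close> demands. Otherwise continuity
  suffices.\<close>

lemma real_analytic_isolated_zero:
  assumes "(\<lambda>h. f (y + h)) has_fps_expansion F" and "F \<noteq> 0"
  shows "eventually (\<lambda>z. f z \<noteq> 0) (at (y::real))"
proof -
  have "eventually (\<lambda>h. f (y + h) \<noteq> 0) (at 0)"
  proof (cases "f y = 0")
    case False
    have "isCont (\<lambda>h. f (y + h)) 0"
      using assms(1) has_fps_expansion_imp_continuous by blast
    then have "((\<lambda>h. f (y + h)) \<longlongrightarrow> f y) (at 0)"
      by (simp add: isCont_def)
    then show ?thesis
      using False by (rule tendsto_imp_eventually_ne)
  next
    case True
    have pos: "fps_conv_radius F > 0"
      and ev: "eventually (\<lambda>h. eval_fps F h = f (y + h)) (nhds 0)"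
      using assms(1) by (auto simp: has_fps_expansion_def)
    have "eventually (\<lambda>h. h \<in> eball 0 (fps_conv_radius F)) (nhds (0::real))"
      using pos by (intro eventually_nhds_in_open) (auto simp: zero_ereal_def)
    with ev have "eventually (\<lambda>h. (\<lambda>n. fps_nth F n * h ^ n) sums f (y + h)) (nhds 0)"
      by eventually_elim (metis in_eball_iff dist_0_norm sums_eval_fps)
    then obtain r where r: "r > 0"
      "\<And>h. norm (h - 0) < r \<Longrightarrow> (\<lambda>n. fps_nth F n * (h - 0) ^ n) sums f (y + h)"
      by (auto simp: eventually_nhds_metric dist_norm)
    obtain m where m: "fps_nth F m \<noteq> 0"
      using assms(2) by (metis fps_eq_iff fps_zero_nth)
    have "(\<lambda>n. fps_nth F n * 0 ^ n) sums f y"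
      using r(2)[of 0] r(1) by simp
    then have "fps_nth F 0 = 0"
      using True powser_sums_zero_iff by metis
    then have "m > 0"
      using m by (metis gr0I)
    obtain s where s: "0 < s" "\<And>h. h \<in> cball 0 s - {0} \<Longrightarrow> f (y + h) \<noteq> 0"
      using powser_0_nonzero[OF r(1,2) _ m \<open>m > 0\<close>] True by auto
    then show ?thesis
      by (auto simp: eventually_at intro!: exI[of _ s])
  qed
  then show ?thesis
    using eventually_at_to_0[of "\<lambda>z. f z \<noteq> 0" y] by (simp add: add.commute)
qed

text \<open>The identity theorem by connectedness: near each point \<open>f\<close> either vanishes
  identically or has no further zero. Both alternatives are open and they exclude each other, so the
  first never occurs; a sparse set of reals is countable.\<close>

lemma real_analytic_countable_zeros:
  assumes "real_analytic f" and "\<exists>y. f y \<noteq> 0"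
  shows "countable {y. f y = 0}"
proof -
  let ?A = "{y. eventually (\<lambda>z. f z = 0) (nhds y)}"
  let ?B = "{y. eventually (\<lambda>z. f z \<noteq> 0) (at y)}"
  have cover: "y \<in> ?A \<union> ?B" for y
  proof -
    obtain F where F: "(\<lambda>h. f (y + h)) has_fps_expansion F"
      using assms(1) unfolding real_analytic_def by blast
    show ?thesis
    proof (cases "F = 0")
      case True
      then have "eventually (\<lambda>h. f (y + h) = 0) (nhds 0)"
        using F by (auto simp: has_fps_expansion_def elim: eventually_mono)
      then have "y \<in> ?A"
        by (auto simp: eventually_nhds_metric dist_real_def)
           (metis add_diff_cancel_left' add.commute diff_add_cancel diff_zero)
      then show ?thesis by blast
    qed (use real_analytic_isolated_zero[OF F] in blast)
  qed
  have "open ?A"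
    unfolding open_subopen[of ?A]
    by (auto simp: eventually_nhds)
  moreover have "open ?B"
  proof (subst open_subopen, safe)
    fix y assume "eventually (\<lambda>z. f z \<noteq> 0) (at y)"
    then obtain S where S: "open S" "y \<in> S" "\<And>z. z \<in> S \<Longrightarrow> z \<noteq> y \<Longrightarrow> f z \<noteq> 0"
      by (auto simp: eventually_at_topological)
    have "S \<subseteq> ?B"
    proof
      fix z assume "z \<in> S"
      show "z \<in> ?B"
      proof (cases "z = y")
        case False
        have "eventually (\<lambda>w. w \<in> S - {y}) (nhds z)"
          using S False \<open>z \<in> S\<close> by (intro eventually_nhds_in_open) auto
        then have "eventually (\<lambda>w. f w \<noteq> 0) (nhds z)"
          by eventually_elim (use S in auto)
        then show ?thesis by (simp add: eventually_nhds_conv_at)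
      qed (use S in \<open>auto simp: eventually_at_topological\<close>)
    qed
    then show "\<exists>T. open T \<and> y \<in> T \<and> T \<subseteq> ?B" using S by blast
  qed
  moreover have "?A \<inter> ?B = {}"
  proof -
    have False if "eventually (\<lambda>z. f z = 0) (nhds y)" "eventually (\<lambda>z. f z \<noteq> 0) (at y)" for y
    proof -
      have "eventually (\<lambda>z. f z = 0) (at y)"
        using that(1) by (simp add: eventually_nhds_conv_at)
      with that(2) have "eventually (\<lambda>z. False) (at y)"
        by eventually_elim simp
      then show False by simp
    qed
    then show ?thesis by blast
  qed
  moreover have "?A \<noteq> UNIV"
    using assms(2) eventually_nhds_x_imp_x by fastforce
  ultimately have "?A = {}"
    using cover connectedD[OF connected_UNIV, of ?A ?B] by blast
  then have "\<forall>y. eventually (\<lambda>z. f z \<noteq> 0) (at y)"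
    using cover by blast
  then have "{y. f y = 0} sparse_in UNIV"
    by (simp add: sparse_in_eventually_iff)
  then show ?thesis
    using sparse_imp_countable[OF open_UNIV] by auto
qed

lemma real_analytic_has_derivative:
  assumes "real_analytic f"
  obtains g where "\<And>y. (f has_real_derivative g y) (at y)"
proof -
  have "\<exists>D. (f has_real_derivative D) (at y)" for y
  proof -
    obtain F where F: "(\<lambda>h. f (y + h)) has_fps_expansion F"
      using assms unfolding real_analytic_def by blast
    then have "(eval_fps F has_field_derivative eval_fps (fps_deriv F) 0) (at 0)"
      and ev: "eventually (\<lambda>h. eval_fps F h = f (y + h)) (nhds 0)"
      by (auto simp: has_fps_expansion_def zero_ereal_def intro!: has_field_derivative_eval_fps)
    then have "((\<lambda>h. f (y + h)) has_field_derivative eval_fps (fps_deriv F) 0) (at 0)"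
      using DERIV_cong_ev[OF refl ev refl] by blast
    then show ?thesis
      using DERIV_shift[of f _ 0 y] by (auto simp: add.commute)
  qed
  then show ?thesis using that by metis
qed

text \<open>Otherwise \<open>\<Phi>\<close> is affine: a positive slope makes it unbounded below at
  -infinity, any other slope keeps it from tending to infinity.\<close>

lemma deriv_nonconstant:
  fixes \<Phi> \<phi> :: "real \<Rightarrow> real"
  assumes "bdd_below (range \<Phi>)" and "filterlim \<Phi> at_top at_top"
    and der: "\<And>y. (\<Phi> has_real_derivative \<phi> y) (at y)"
  shows "\<exists>y. \<phi> y \<noteq> u"
proof (rule ccontr)
  assume "\<not> ?thesis"
  then have u: "\<phi> y = u" for y by blast
  have "((\<lambda>y. \<Phi> y - u * y) has_real_derivative 0) (at y)" for y
    using der[of y] by (auto intro!: derivative_eq_intros simp: u)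
  then have const: "\<Phi> y - u * y = \<Phi> 0 - u * 0" for y
    using DERIV_isconst_all[of "\<lambda>y. \<Phi> y - u * y" y 0] by blast
  have \<Phi>: "\<Phi> y = \<Phi> 0 + u * y" for y
    using const[of y] by simp
  obtain b where b: "\<And>y. b \<le> \<Phi> y"
    using assms(1) by (auto simp: bdd_below_def)
  show False
  proof (cases "u > 0")
    case True
    then show False
      \<comment> \<open>At this point the affine function takes the value
        \<open>b - 1\<close>.\<close>
      using b[of "(b - \<Phi> 0 - 1) / u"] \<Phi>[of "(b - \<Phi> 0 - 1) / u"] by simp
  next
    case False
    obtain R where R: "\<And>y. y \<ge> R \<Longrightarrow> \<Phi> y > \<Phi> 0"
      using assms(2) by (auto simp: filterlim_at_top_dense eventually_at_top_linorder)
    have "u * max R 0 \<le> 0"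
      using False by (intro mult_nonpos_nonneg) auto
    then show False
      using R[of "max R 0"] \<Phi>[of "max R 0"] by simp
  qed
qed

section \<open>Short-time flows of Lipschitz vector fields\<close>

text \<open>A Gronwall estimate without exponentials: the mean value inequality bounds the maximum
  of the norm by itself, and \<open>h * K \<le> 1/2\<close> allows half of it to be absorbed. With
  \<open>a = 0\<close> and \<open>f 0 = 0\<close> it is the uniqueness argument for differential
  equations used below.\<close>

lemma short_time_bound:
  fixes f :: "real \<Rightarrow> 'a::real_normed_vector"
  assumes der: "\<And>t. t \<in> {0..h} \<Longrightarrow> (f has_vector_derivative f' t) (at t within {0..h})"
    and bd: "\<And>t. t \<in> {0..h} \<Longrightarrow> norm (f' t) \<le> a + K * norm (f t)"
    and "0 \<le> K" "0 \<le> a" "h * K \<le> 1/2" and t: "t \<in> {0..h}"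
  shows "norm (f t) \<le> 2 * (norm (f 0) + h * a)"
proof -
  have "continuous_on {0..h} f"
    using der has_vector_derivative_continuous continuous_on_eq_continuous_within by blast
  then have "continuous_on {0..h} (\<lambda>t. norm (f t))"
    by (intro continuous_intros)
  then obtain s where s: "s \<in> {0..h}" and max: "\<And>t. t \<in> {0..h} \<Longrightarrow> norm (f t) \<le> norm (f s)"
    using continuous_attains_sup[of "{0..h}" "\<lambda>t. norm (f t)"] t by auto
  let ?M = "norm (f s)"
  have "norm (f s - f 0) \<le> (a + K * ?M) * norm (s - 0)"
  proof (rule differentiable_bound[of "{0..h}"])
    fix x assume x: "x \<in> {0..h}"
    show "(f has_derivative (\<lambda>u. u *\<^sub>R f' x)) (at x within {0..h})"
      using der[OF x] by (simp add: has_vector_derivative_def)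
    have "norm (f' x) \<le> a + K * ?M"
      using bd[OF x] mult_left_mono[OF max[OF x] \<open>0 \<le> K\<close>] by linarith
    then show "onorm (\<lambda>u. u *\<^sub>R f' x) \<le> a + K * ?M"
      by (simp add: onorm_scaleR_left onorm_id)
  qed (use s in auto)
  also have "\<dots> \<le> (a + K * ?M) * h"
    using s assms(3,4) by (intro mult_left_mono) auto
  also have "\<dots> = h * a + (h * K) * ?M"
    by (simp add: algebra_simps)
  also have "\<dots> \<le> h * a + (1/2) * ?M"
    using assms(5) by (intro add_left_mono mult_right_mono) auto
  finally have "norm (f s - f 0) \<le> h * a + ?M / 2"
    by simp
  then have "?M \<le> 2 * (norm (f 0) + h * a)"
    using norm_triangle_ineq2[of "f s" "f 0"] by argo
  then show ?thesis
    using max[OF t] by linarith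
qed

lemma lipschitz_ivp:
  fixes G :: "'a::euclidean_space \<Rightarrow> 'a"
  assumes lip: "K-lipschitz_on UNIV G" and "0 \<le> h" "h * K \<le> 1/2"
  obtains \<gamma> where "\<gamma> 0 = x"
    "\<And>t. t \<in> {0..h} \<Longrightarrow> (\<gamma> has_vector_derivative G (\<gamma> t)) (at t within {0..h})"
proof -
  have K: "0 \<le> K" using lip lipschitz_on_nonneg by blast
  have contG: "continuous_on UNIV G"
    using lip lipschitz_on_continuous_on by blast
  define I where "I g t = x + integral {0..t} (\<lambda>s. G (g s))" for g :: "real \<Rightarrow> 'a" and t
  have contGg: "continuous_on S (\<lambda>s. G (apply_bcontfun g s))" for g :: "real \<Rightarrow>\<^sub>C 'a" and S
    by (rule continuous_on_compose2[OF contG]) auto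
  have I_der: "(I (apply_bcontfun g) has_vector_derivative G (apply_bcontfun g t)) (at t within {0..h})"
    if "t \<in> {0..h}" for g t
    unfolding I_def
    using integral_has_vector_derivative[OF contGg that] by (auto intro!: derivative_eq_intros)
  \<comment> \<open>Picard iteration lives in the complete space of bounded continuous functions on
    the whole line; \<open>clamp\<close> extends each iterate from \<open>{0..h}\<close> by
    constants. Short time makes the contraction factor 1/2.\<close>
  have "\<exists>P. \<forall>t. apply_bcontfun P t = I (apply_bcontfun g) (clamp 0 h t)" for g
  proof -
    have "continuous_on (cbox 0 h) (I (apply_bcontfun g))"
      using I_der has_vector_derivative_continuous
      by (fastforce simp: continuous_on_eq_continuous_within)
    then obtain P :: "real \<Rightarrow>\<^sub>C 'a" where "\<And>t. P t = I (apply_bcontfun g) (clamp 0 h t)"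
      using continuous_on_cbox_bcontfunE by blast
    then show ?thesis by blast
  qed
  then obtain P where P: "\<And>g t. apply_bcontfun (P g) t = I (apply_bcontfun g) (clamp 0 h t)"
    by metis
  have clamp: "clamp 0 h t \<in> {0..h}" for t
    using clamp_in_interval[of 0 h t] \<open>0 \<le> h\<close> by auto
  have contr: "dist (P g1) (P g2) \<le> 1/2 * dist g1 g2" for g1 g2
  proof (rule dist_bound)
    fix t
    let ?s = "clamp 0 h t"
    have s: "?s \<in> {0..h}" by (rule clamp)
    have int: "(\<lambda>s. G (apply_bcontfun g s)) integrable_on {0..?s}" for g
      by (rule integrable_continuous_real[OF contGg])
    have "dist (P g1 t) (P g2 t) = norm (integral {0..?s} (\<lambda>s. G (apply_bcontfun g1 s) - G (apply_bcontfun g2 s)))"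
      by (simp add: P I_def dist_norm integral_diff[OF int int])
    also have "\<dots> \<le> (K * dist g1 g2) * (?s - 0)"
    proof (rule integral_bound)
      fix s
      have "norm (G (apply_bcontfun g1 s) - G (apply_bcontfun g2 s)) \<le> K * dist (apply_bcontfun g1 s) (apply_bcontfun g2 s)"
        using lipschitz_onD[OF lip, of "apply_bcontfun g1 s" "apply_bcontfun g2 s"] by (simp add: dist_norm)
      also have "\<dots> \<le> K * dist g1 g2"
        by (intro mult_left_mono dist_bounded K)
      finally show "norm (G (apply_bcontfun g1 s) - G (apply_bcontfun g2 s)) \<le> K * dist g1 g2" .
    qed (use s in \<open>auto intro!: continuous_on_diff contGg\<close>)
    also have "\<dots> \<le> (h * K) * dist g1 g2"
      using mult_left_mono[of "?s" h "K * dist g1 g2"] s K by (simp add: mult_ac)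
    also have "\<dots> \<le> 1/2 * dist g1 g2"
      using assms(3) by (intro mult_right_mono) auto
    finally show "dist (P g1 t) (P g2 t) \<le> 1/2 * dist g1 g2" .
  qed
  obtain g where g: "P g = g"
    using banach_fix_type[of "1/2" P] contr by auto
  have eq: "apply_bcontfun g t = I (apply_bcontfun g) t" if "t \<in> {0..h}" for t
    using P[of g t] g that clamp_cancel_cbox[of t 0 h] by auto
  show ?thesis
  proof
    show "apply_bcontfun g 0 = x"
      using eq[of 0] \<open>0 \<le> h\<close> by (simp add: I_def)
    show "(apply_bcontfun g has_vector_derivative G (apply_bcontfun g t)) (at t within {0..h})"
      if "t \<in> {0..h}" for t
      by (rule has_vector_derivative_transform[OF that _ I_der[OF that]]) (simp add: eq)
  qed
qed

text \<open>Nearest-point projection onto the ball turns \<open>G\<close> into a bounded, globally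
  Lipschitz field without changing it on the ball. For a short time curves from the half ball stay
  in the ball, where they are integral curves of \<open>G\<close> itself.\<close>

lemma local_flow:
  fixes G :: "'a::euclidean_space \<Rightarrow> 'a"
  assumes lip: "K-lipschitz_on (cball E \<rho>) G" and "\<rho> > 0"
  obtains h Fl where "h > 0" "h * K \<le> 1/2"
    "\<And>x. x \<in> cball E (\<rho>/2) \<Longrightarrow> Fl 0 x = x"
    "\<And>x t. x \<in> cball E (\<rho>/2) \<Longrightarrow> t \<in> {0..h} \<Longrightarrow> Fl t x \<in> cball E \<rho>"
    "\<And>x t. x \<in> cball E (\<rho>/2) \<Longrightarrow> t \<in> {0..h} \<Longrightarrow>
       ((\<lambda>t. Fl t x) has_vector_derivative G (Fl t x)) (at t within {0..h})"
    "\<And>x y t. x \<in> cball E (\<rho>/2) \<Longrightarrow> y \<in> cball E (\<rho>/2) \<Longrightarrow> t \<in> {0..h} \<Longrightarrow>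
       dist (Fl t x) (Fl t y) \<le> 2 * dist x y"
proof -
  let ?D = "cball E \<rho>"
  define T where "T = G \<circ> closest_point ?D"
  have K: "0 \<le> K" using lip lipschitz_on_nonneg by blast
  have D: "convex ?D" "closed ?D" "?D \<noteq> {}"
    using \<open>\<rho> > 0\<close> by auto
  have lipT: "K-lipschitz_on UNIV T"
  proof (rule lipschitz_onI)
    fix x y
    have "dist (T x) (T y) \<le> K * dist (closest_point ?D x) (closest_point ?D y)"
      unfolding T_def comp_def
      by (rule lipschitz_onD[OF lip]) (use D closest_point_in_set in blast)+
    also have "\<dots> \<le> K * dist x y"
      by (intro mult_left_mono closest_point_lipschitz D K)
    finally show "dist (T x) (T y) \<le> K * dist x y" .
  qed (rule K)
  have TG: "T x = G x" if "x \<in> ?D" for x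
    using that by (simp add: T_def closest_point_self)
  define B where "B = norm (G E) + K * \<rho> + 1"
  have B: "norm (T x) \<le> B" "0 < B" for x
  proof -
    let ?c = "closest_point ?D x"
    have c: "?c \<in> ?D" using D closest_point_in_set by blast
    have "dist (G ?c) (G E) \<le> K * dist ?c E"
      by (rule lipschitz_onD[OF lip c]) (use \<open>\<rho> > 0\<close> in auto)
    also have "\<dots> \<le> K * \<rho>"
      using c K by (intro mult_left_mono) (auto simp: dist_commute)
    finally show "norm (T x) \<le> B"
      unfolding B_def T_def comp_def dist_norm using norm_triangle_ineq2[of "G ?c" "G E"] by linarith
    show "0 < B" unfolding B_def using K \<open>\<rho> > 0\<close>
      by (smt (verit) mult_nonneg_nonneg norm_ge_zero)
  qed
  \<comment> \<open>The first entry gives \<open>h * K \<le> 1/2\<close>; the second keeps the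
    displacement, at speed at most \<open>B\<close>, below the gap \<open>\<rho> / 2\<close> between
    the two balls.\<close>
  define h where "h = min (1 / (2 * (K + 1))) (\<rho> / (2 * B))"
  have h: "h > 0" "h * K \<le> 1/2" "B * h \<le> \<rho> / 2"
  proof -
    show "h > 0" using K B \<open>\<rho> > 0\<close> by (auto simp: h_def)
    have "h * K \<le> 1 / (2 * (K + 1)) * K"
      unfolding h_def by (intro mult_right_mono K) auto
    also have "\<dots> \<le> 1/2" using K by (simp add: field_simps)
    finally show "h * K \<le> 1/2" .
    have "B * h \<le> B * (\<rho> / (2 * B))"
      unfolding h_def using B by (intro mult_left_mono) auto
    then show "B * h \<le> \<rho> / 2" using B(2) by simp
  qed
  have "\<exists>\<gamma>. \<gamma> 0 = x \<and> (\<forall>t\<in>{0..h}. (\<gamma> has_vector_derivative T (\<gamma> t)) (at t within {0..h}))" for x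
    using lipschitz_ivp[OF lipT _ h(2), of x] h(1) by (metis less_imp_le)
  then obtain \<Gamma> where \<Gamma>: "\<And>x. \<Gamma> x 0 = x"
    "\<And>x t. t \<in> {0..h} \<Longrightarrow> (\<Gamma> x has_vector_derivative T (\<Gamma> x t)) (at t within {0..h})"
    by metis
  have stay: "\<Gamma> x t \<in> ?D" if x: "x \<in> cball E (\<rho>/2)" and t: "t \<in> {0..h}" for x t
  proof -
    have "norm (\<Gamma> x t - \<Gamma> x 0) \<le> B * norm (t - 0)"
    proof (rule differentiable_bound[of "{0..h}"])
      show "(\<Gamma> x has_derivative (\<lambda>u. u *\<^sub>R T (\<Gamma> x s))) (at s within {0..h})" if "s \<in> {0..h}" for s
        using \<Gamma>(2)[OF that] by (simp add: has_vector_derivative_def)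
      show "onorm (\<lambda>u. u *\<^sub>R T (\<Gamma> x s)) \<le> B" for s
        using B by (simp add: onorm_scaleR_left onorm_id)
    qed (use t in auto)
    also have "\<dots> \<le> B * h" using t B by (intro mult_left_mono) (auto intro: less_imp_le)
    finally have "dist (\<Gamma> x t) x \<le> \<rho> / 2"
      using h \<Gamma>(1) by (simp add: dist_norm)
    then show ?thesis
      using x dist_triangle[of E "\<Gamma> x t" x] by (auto simp: dist_commute)
  qed
  show ?thesis
  proof (rule that[of h "\<lambda>t x. \<Gamma> x t"])
    fix x y t
    assume xy: "x \<in> cball E (\<rho>/2)" "y \<in> cball E (\<rho>/2)" and t: "t \<in> {0..h}"
    have "norm (\<Gamma> x t - \<Gamma> y t) \<le> 2 * (norm (\<Gamma> x 0 - \<Gamma> y 0) + h * 0)"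
    proof (rule short_time_bound[where K = K and f' = "\<lambda>t. T (\<Gamma> x t) - T (\<Gamma> y t)"])
      show "((\<lambda>a. \<Gamma> x a - \<Gamma> y a) has_vector_derivative T (\<Gamma> x t) - T (\<Gamma> y t)) (at t within {0..h})"
        if "t \<in> {0..h}" for t
        using \<Gamma>(2)[OF that] by (intro has_vector_derivative_diff)
      show "norm (T (\<Gamma> x t) - T (\<Gamma> y t)) \<le> 0 + K * norm (\<Gamma> x t - \<Gamma> y t)" for t
        using lipschitz_onD[OF lipT, of "\<Gamma> x t" "\<Gamma> y t"] by (simp add: dist_norm)
    qed (use K h t in auto)
    then show "dist (\<Gamma> x t) (\<Gamma> y t) \<le> 2 * dist x y"
      by (simp add: \<Gamma> dist_norm)
  next
    fix x t
    assume xt: "x \<in> cball E (\<rho>/2)" "t \<in> {0..h}"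
    show "(\<Gamma> x has_vector_derivative G (\<Gamma> x t)) (at t within {0..h})"
      using \<Gamma>(2)[OF xt(2), of x] stay[OF xt] by (simp add: TG)
  qed (use h \<Gamma> stay in auto)
qed

text \<open>Linearity of the solution map is uniqueness: the defects of additivity and homogeneity
  solve the same linear equation and start at 0.\<close>

lemma linear_flow:
  fixes M :: "'a::euclidean_space \<Rightarrow> 'a"
  assumes "bounded_linear M"
  obtains h Y where "h > 0" "h * onorm M \<le> 1/2" "\<And>z. Y 0 z = z"
    "\<And>t. t \<in> {0..h} \<Longrightarrow> bounded_linear (Y t)"
    "\<And>t z. t \<in> {0..h} \<Longrightarrow> ((\<lambda>t. Y t z) has_vector_derivative M (Y t z)) (at t within {0..h})"
proof -
  interpret M: bounded_linear M by fact
  have lip: "(onorm M)-lipschitz_on UNIV M"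
    by (rule lipschitz_onI)
       (auto simp: dist_norm M.diff[symmetric] onorm[OF assms] onorm_pos_le[OF assms])
  define h where "h = 1 / (2 * (onorm M + 1))"
  have K: "0 \<le> onorm M" by (rule onorm_pos_le[OF assms])
  then have h: "h > 0" "h * onorm M \<le> 1/2"
    by (auto simp: h_def field_simps)
  have "\<exists>\<gamma>. \<gamma> 0 = x \<and> (\<forall>t\<in>{0..h}. (\<gamma> has_vector_derivative M (\<gamma> t)) (at t within {0..h}))" for x
    using lipschitz_ivp[OF lip _ h(2), of x] h(1) by (metis less_imp_le)
  then obtain Y where Y: "\<And>x. Y x 0 = x"
    "\<And>x t. t \<in> {0..h} \<Longrightarrow> (Y x has_vector_derivative M (Y x t)) (at t within {0..h})"
    by metis
  have zero: "f t = 0" if "\<And>t. t \<in> {0..h} \<Longrightarrow> (f has_vector_derivative M (f t)) (at t within {0..h})"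
    "f 0 = 0" "t \<in> {0..h}" for f t
  proof -
    have "norm (f t) \<le> 2 * (norm (f 0) + h * 0)"
      by (rule short_time_bound[where K = "onorm M" and f' = "\<lambda>t. M (f t)"])
         (use that h K onorm[OF assms] in auto)
    then show ?thesis using that by simp
  qed
  show ?thesis
  proof (rule that[of h "\<lambda>t x. Y x t"])
    fix t assume t: "t \<in> {0..h}"
    have add: "Y (x + y) t = Y x t + Y y t" for x y
      using zero[of "\<lambda>t. Y (x + y) t - (Y x t + Y y t)" t] Y t
      by (simp add: M.add M.diff has_vector_derivative_diff has_vector_derivative_add)
    have scale: "Y (c *\<^sub>R x) t = c *\<^sub>R Y x t" for c x
    proof -
      have "((\<lambda>t. Y (c *\<^sub>R x) t - c *\<^sub>R Y x t) has_vector_derivative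
         M (Y (c *\<^sub>R x) t - c *\<^sub>R Y x t)) (at t within {0..h})" if "t \<in> {0..h}" for t
        using Y(2)[OF that]
        by (auto intro!: derivative_eq_intros simp: M.diff M.scaleR)
      then show ?thesis
        using zero[of "\<lambda>t. Y (c *\<^sub>R x) t - c *\<^sub>R Y x t" t] Y t by simp
    qed
    show "bounded_linear (\<lambda>x. Y x t)"
      by (rule linear_conv_bounded_linear[THEN iffD1], rule linearI) (auto simp: add scale)
  qed (use h Y in auto)
qed

text \<open>Along a constant solution the variational equation has constant coefficients. The
  remainder \<open>Fl s y - E - Y s (y - E)\<close> starts at 0 and solves that equation up to an
  error of order \<open>e' * norm (y - E)\<close>, so no differentiability of \<open>G\<close> away
  from \<open>E\<close> is involved.\<close>

lemma flow_derivative_at_equilibrium: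
  fixes G :: "'a::euclidean_space \<Rightarrow> 'a"
  assumes "h > 0" "\<rho> > 0"
    and init: "\<And>x. x \<in> cball E \<rho> \<Longrightarrow> Fl 0 x = x"
    and Fl: "\<And>x t. x \<in> cball E \<rho> \<Longrightarrow> t \<in> {0..h} \<Longrightarrow>
       ((\<lambda>t. Fl t x) has_vector_derivative G (Fl t x)) (at t within {0..h})"
    and lip: "\<And>x y t. x \<in> cball E \<rho> \<Longrightarrow> y \<in> cball E \<rho> \<Longrightarrow> t \<in> {0..h} \<Longrightarrow>
       dist (Fl t x) (Fl t y) \<le> 2 * dist x y"
    and fix_E: "\<And>t. t \<in> {0..h} \<Longrightarrow> Fl t E = E"
    and "G E = 0" and M: "(G has_derivative M) (at E)" and hM: "h * onorm M \<le> 1/2"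
    and Y0: "\<And>z. Y 0 z = z" and lin: "\<And>t. t \<in> {0..h} \<Longrightarrow> bounded_linear (Y t)"
    and Y: "\<And>t z. t \<in> {0..h} \<Longrightarrow> ((\<lambda>t. Y t z) has_vector_derivative M (Y t z)) (at t within {0..h})"
    and t: "t \<in> {0..h}"
  shows "(Fl t has_derivative Y t) (at E)"
  unfolding has_derivative_at_alt
proof (intro conjI allI impI)
  have "bounded_linear M" using M by (rule has_derivative_bounded_linear)
  then interpret M: bounded_linear M .
  show "bounded_linear (Y t)" using lin t .
  fix e :: real assume "e > 0"
  \<comment> \<open>The 4 collects a factor 2 from \<open>short_time_bound\<close> and a factor 2
    from the Lipschitz bound of the flow.\<close>
  define e' where "e' = e / (4 * h)"
  have "e' > 0" using \<open>e > 0\<close> \<open>h > 0\<close> by (simp add: e'_def)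
  then obtain d where d: "d > 0" "\<And>y. norm (y - E) < d \<Longrightarrow> norm (G y - G E - M (y - E)) \<le> e' * norm (y - E)"
    using M unfolding has_derivative_at_alt by blast
  show "\<exists>d>0. \<forall>y. norm (y - E) < d \<longrightarrow> norm (Fl t y - Fl t E - Y t (y - E)) \<le> e * norm (y - E)"
  \<comment> \<open>The flow at most doubles the distance to \<open>E\<close>, so \<open>d/2\<close>
    keeps \<open>Fl s y\<close> within \<open>d\<close> of \<open>E\<close>.\<close>
  proof (intro exI[of _ "min \<rho> (d/2)"] conjI allI impI)
    fix y assume y: "norm (y - E) < min \<rho> (d/2)"
    then have yE: "y \<in> cball E \<rho>" "E \<in> cball E \<rho>"
      using \<open>\<rho> > 0\<close> by (auto simp: dist_norm norm_minus_commute)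
    let ?f = "\<lambda>s. Fl s y - E - Y s (y - E)"
    have "norm (?f t) \<le> 2 * (norm (?f 0) + h * (2 * e' * norm (y - E)))"
    proof (rule short_time_bound[where K = "onorm M" and f' = "\<lambda>s. G (Fl s y) - M (Y s (y - E))"])
      fix s assume s: "s \<in> {0..h}"
      show "(?f has_vector_derivative G (Fl s y) - M (Y s (y - E))) (at s within {0..h})"
        using Fl[OF yE(1) s] Y[OF s] by (auto intro!: derivative_eq_intros)
      have le: "norm (Fl s y - E) \<le> 2 * norm (y - E)"
        using lip[OF yE s] fix_E[OF s] by (simp add: dist_norm)
      have "norm (G (Fl s y) - M (Fl s y - E)) \<le> e' * norm (Fl s y - E)"
        using d(2)[of "Fl s y"] le y \<open>G E = 0\<close> by auto
      also have "\<dots> \<le> 2 * e' * norm (y - E)"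
        using mult_left_mono[OF le, of e'] \<open>e' > 0\<close> by (simp add: mult_ac)
      finally have 1: "norm (G (Fl s y) - M (Fl s y - E)) \<le> 2 * e' * norm (y - E)" .
      have "G (Fl s y) - M (Y s (y - E)) = (G (Fl s y) - M (Fl s y - E)) + M (?f s)"
        by (simp add: M.diff)
      also have "norm \<dots> \<le> 2 * e' * norm (y - E) + onorm M * norm (?f s)"
        by (rule norm_triangle_mono[OF 1 onorm]) fact
      finally show "norm (G (Fl s y) - M (Y s (y - E))) \<le> 2 * e' * norm (y - E) + onorm M * norm (?f s)" .
    qed (use t hM \<open>e' > 0\<close> onorm_pos_le[OF \<open>bounded_linear M\<close>] in auto)
    also have "\<dots> = e * norm (y - E)"
      using \<open>h > 0\<close> by (simp add: init[OF yE(1)] Y0 e'_def field_simps)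
    finally show "norm (Fl t y - Fl t E - Y t (y - E)) \<le> e * norm (y - E)"
      by (simp add: fix_E[OF t])
  qed (use \<open>\<rho> > 0\<close> d in auto)
qed

section \<open>Reachability\<close>

definition reach :: "('c \<Rightarrow> 'a::real_normed_vector \<Rightarrow> 'a) \<Rightarrow> 'a \<Rightarrow> 'a \<Rightarrow> bool" where
  "reach F = (\<lambda>x y. \<exists>c t. 0 \<le> t \<and> flow_maps (F c) t x y)\<^sup>*\<^sup>*"

lemma reach_refl: "reach F x x"
  by (simp add: reach_def)

lemma reach_trans: "reach F x y \<Longrightarrow> reach F y z \<Longrightarrow> reach F x z"
  unfolding reach_def by (rule rtranclp_trans)

lemma flow_maps_imp_reach: "0 \<le> t \<Longrightarrow> flow_maps (F c) t x y \<Longrightarrow> reach F x y"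
  unfolding reach_def by blast

lemma flow_mapsI:
  assumes "\<gamma> 0 = x" "\<gamma> t = y" "t \<le> h"
    and "\<And>s. s \<in> {0..h} \<Longrightarrow> (\<gamma> has_vector_derivative X (\<gamma> s)) (at s within {0..h})"
  shows "flow_maps X t x y"
  unfolding flow_maps_def
proof (intro exI conjI ballI)
  show "(\<gamma> has_vector_derivative X (\<gamma> s)) (at s within {0..t})" if "s \<in> {0..t}" for s
    by (rule has_vector_derivative_within_subset[OF assms(4)]) (use that assms(3) in auto)
qed (fact assms)+

lemma reach_imp_attainable:
  assumes "reach F x y"
  shows "y \<in> attainable F x"
  using assms unfolding reach_def
proof (induction rule: rtranclp_induct)
  case base
  \<comment> \<open>\<open>attainable\<close> asks for at least one flow, so the empty path becomes
    a flow of duration 0.\<close>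
  have "flow_maps (F c) 0 x x" for c
    unfolding flow_maps_def
    by (rule exI[of _ "\<lambda>_. x"]) (simp add: has_vector_derivative_def has_derivative_within_singleton_iff bounded_linear_scaleR_left)
  then show ?case
    unfolding attainable_def
    by (intro CollectI exI[of _ 1] exI[of _ "\<lambda>_. undefined"] exI[of _ "\<lambda>_. 0"] exI[of _ "\<lambda>_. x"] conjI) auto
next
  case (step y w)
  then obtain c t where ct: "0 \<le> t" "flow_maps (F c) t y w" by blast
  obtain N :: nat and cs ts z where N: "N \<ge> 1" "z N = x" "z 0 = y"
    "\<forall>j\<in>{1..N}. ts j \<ge> 0 \<and> flow_maps (F (cs j)) (ts j) (z j) (z (j - 1))"
    using step.IH unfolding attainable_def by blast
  \<comment> \<open>The flow acting last has index 1: the new one is put there, the others move up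
    by one, and \<open>w\<close> becomes the point of index 0.\<close>
  show ?case
    unfolding attainable_def
  proof (intro CollectI exI conjI ballI)
    fix j assume j: "j \<in> {1..Suc N}"
    show "0 \<le> (if j = 1 then t else ts (j - 1))"
      and "flow_maps (F (if j = 1 then c else cs (j - 1))) (if j = 1 then t else ts (j - 1))
        (if j = 0 then w else z (j - 1)) (if j - 1 = 0 then w else z (j - 1 - 1))"
    proof (atomize (full), cases "j = 1")
      case True
      then show "0 \<le> (if j = 1 then t else ts (j - 1)) \<and>
        flow_maps (F (if j = 1 then c else cs (j - 1))) (if j = 1 then t else ts (j - 1))
        (if j = 0 then w else z (j - 1)) (if j - 1 = 0 then w else z (j - 1 - 1))"
        using ct N(3) by simp
    next
      case False
      then have "j - 1 \<in> {1..N}" "j - 1 \<noteq> 0" "j \<noteq> 0" using j by auto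
      then show "0 \<le> (if j = 1 then t else ts (j - 1)) \<and>
        flow_maps (F (if j = 1 then c else cs (j - 1))) (if j = 1 then t else ts (j - 1))
        (if j = 0 then w else z (j - 1)) (if j - 1 = 0 then w else z (j - 1 - 1))"
        using bspec[OF N(4), of "j - 1"] False by simp
    qed
  qed (use N in auto)
qed

lemma has_vector_derivative_reverse:
  assumes "(\<gamma> has_vector_derivative \<gamma>') (at (t - s) within {0..t})"
  shows "((\<lambda>s. \<gamma> (t - s)) has_vector_derivative - \<gamma>') (at s within {0..t::real})"
proof -
  have "(\<lambda>s. t - s) ` {0..t} = {0..t}"
    by (auto intro!: image_eqI[of _ _ "t - _"])
  moreover have "((\<lambda>s. t - s) has_vector_derivative - 1) (at s within {0..t})"
    by (auto intro!: derivative_eq_intros)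
  ultimately show ?thesis
    using vector_diff_chain_within[of "\<lambda>s. t - s" "-1" s "{0..t}" \<gamma> \<gamma>'] assms by (simp add: comp_def)
qed

lemma has_vector_derivative_fst:
  assumes "(f has_vector_derivative f') (at t within S)"
  shows "((\<lambda>t. fst (f t)) has_vector_derivative fst f') (at t within S)"
  using bounded_linear.has_vector_derivative[OF bounded_linear_fst assms] .

lemma has_vector_derivative_snd:
  assumes "(f has_vector_derivative f') (at t within S)"
  shows "((\<lambda>t. snd (f t)) has_vector_derivative snd f') (at t within S)"
  using bounded_linear.has_vector_derivative[OF bounded_linear_snd assms] .

text \<open>The control value is carried as an additional, constant component of the state, so that
  facts about the flow of one vector field cover the dependence on the control.\<close>

definition control_field :: "('c \<Rightarrow> 'a \<Rightarrow> 'a) \<Rightarrow> 'a \<times> 'c \<Rightarrow> 'a \<times> 'c::real_vector" where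
  "control_field F = (\<lambda>(x, c). (F c x, 0))"

lemma control_flow:
  fixes Fl :: "real \<Rightarrow> 'a::real_normed_vector \<times> 'c::real_normed_vector \<Rightarrow> 'a \<times> 'c"
  assumes "\<And>s. s \<in> {0..h} \<Longrightarrow>
      ((\<lambda>t. Fl t (x, c)) has_vector_derivative control_field F (Fl s (x, c))) (at s within {0..h})"
    and init: "Fl 0 (x, c) = (x, c)" and t: "t \<in> {0..h}"
  shows "snd (Fl t (x, c)) = c" "flow_maps (F c) t x (fst (Fl t (x, c)))"
proof -
  have *: "snd (Fl t (x, c)) = c" if "t \<in> {0..h}" for t
  proof -
    have "norm (snd (Fl t (x, c)) - c) \<le> 2 * (norm (snd (Fl 0 (x, c)) - c) + h * 0)"
      by (rule short_time_bound[where K = 0 and f' = "\<lambda>_. 0"])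
         (use that assms(1)[THEN has_vector_derivative_snd] in
           \<open>auto intro!: derivative_eq_intros simp: control_field_def case_prod_beta\<close>)
    then show ?thesis by (simp add: init)
  qed
  then show "snd (Fl t (x, c)) = c" using t .
  show "flow_maps (F c) t x (fst (Fl t (x, c)))"
  proof (rule flow_mapsI[of "\<lambda>t. fst (Fl t (x, c))" _ _ _ h])
    show "((\<lambda>t. fst (Fl t (x, c))) has_vector_derivative F c (fst (Fl s (x, c)))) (at s within {0..h})"
      if "s \<in> {0..h}" for s
      using assms(1)[OF that, THEN has_vector_derivative_fst] *[OF that]
      by (simp add: control_field_def case_prod_beta)
  qed (use t init in auto)
qed

section \<open>Local controllability at an equilibrium\<close>

text \<open>Among the derivatives at \<open>0\<close> of continuous families of points reachable from the equilibrium, take one,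
  \<open>L\<close>, of maximal rank. Following the family by the flow of the control \<open>c0 + (\<eta> \<bullet> s) \<beta>\<close> with \<open>\<eta>\<close> in the
  kernel of \<open>L\<close> cannot increase the rank, hence the response to the control \<open>\<beta>\<close>, transported
  back along the linearised flow, stays in the range of \<open>L\<close>. Its derivatives at time \<open>0\<close> are,
  up to sign, the vectors of the Kalman condition.\<close>

lemma local_reach:
  fixes F :: "'c::euclidean_space \<Rightarrow> 'a::euclidean_space \<Rightarrow> 'a"
  assumes lip: "K-lipschitz_on (cball (e, c0) \<rho>) (control_field F)" and "\<rho> > 0"
    and eq: "F c0 e = 0"
    and der: "(control_field F has_derivative (\<lambda>(z, \<beta>). (A z + B \<beta>, 0))) (at (e, c0))"
    and A: "bounded_linear A" and B: "bounded_linear B"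
    and kalman: "\<And>\<xi>. (\<And>k \<beta>. \<xi> \<bullet> (A ^^ k) (B \<beta>) = 0) \<Longrightarrow> \<xi> = 0"
  shows "\<exists>r>0. \<forall>y\<in>ball e r. reach F e y"
proof -
  interpret A: bounded_linear A by fact
  interpret B: bounded_linear B by fact
  let ?E = "(e, c0)" and ?G = "control_field F"
  define M where "M = (\<lambda>(z, \<beta>). (A z + B \<beta>, 0::'c))"
  have M: "(?G has_derivative M) (at ?E)" using der by (simp add: M_def)
  then have "bounded_linear M" by (rule has_derivative_bounded_linear)
  obtain h1 Fl where h1: "h1 > 0" "h1 * K \<le> 1/2"
    and Fl0: "\<And>x. x \<in> cball ?E (\<rho>/2) \<Longrightarrow> Fl 0 x = x"
    and Fl_in: "\<And>x t. x \<in> cball ?E (\<rho>/2) \<Longrightarrow> t \<in> {0..h1} \<Longrightarrow> Fl t x \<in> cball ?E \<rho>"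
    and Fl1: "\<And>x t. x \<in> cball ?E (\<rho>/2) \<Longrightarrow> t \<in> {0..h1} \<Longrightarrow>
       ((\<lambda>t. Fl t x) has_vector_derivative ?G (Fl t x)) (at t within {0..h1})"
    and Fl_lip: "\<And>x y t. x \<in> cball ?E (\<rho>/2) \<Longrightarrow> y \<in> cball ?E (\<rho>/2) \<Longrightarrow> t \<in> {0..h1} \<Longrightarrow>
       dist (Fl t x) (Fl t y) \<le> 2 * dist x y"
    by (rule local_flow[OF lip \<open>\<rho> > 0\<close>]) (rule that; assumption)
  obtain h2 Y where h2: "h2 > 0" "h2 * onorm M \<le> 1/2" and Y0: "\<And>z. Y 0 z = z"
    and Y_lin: "\<And>t. t \<in> {0..h2} \<Longrightarrow> bounded_linear (Y t)"
    and Y2: "\<And>t z. t \<in> {0..h2} \<Longrightarrow> ((\<lambda>t. Y t z) has_vector_derivative M (Y t z)) (at t within {0..h2})"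
    by (rule linear_flow[OF \<open>bounded_linear M\<close>]) (rule that; assumption)
  \<comment> \<open>A common lifetime for the flow, its linearisation and the equation for
    \<open>R\<close> below, whose Lipschitz constant is \<open>onorm A\<close>.\<close>
  define h where "h = min (min h1 h2) (1 / (2 * (onorm A + 1)))"
  have nA: "0 \<le> onorm A" by (rule onorm_pos_le[OF A])
  have h: "h > 0" "h \<le> h1" "h \<le> h2" "h * onorm A \<le> 1/2"
  proof -
    show "h > 0" "h \<le> h1" "h \<le> h2" using h1 h2 nA by (auto simp: h_def)
    have "h * onorm A \<le> 1 / (2 * (onorm A + 1)) * onorm A"
      unfolding h_def by (intro mult_right_mono nA) auto
    also have "\<dots> \<le> 1/2" using nA by (simp add: field_simps)
    finally show "h * onorm A \<le> 1/2" .
  qed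
  have Fl: "((\<lambda>t. Fl t x) has_vector_derivative ?G (Fl t x)) (at t within {0..h})"
    if "x \<in> cball ?E (\<rho>/2)" "t \<in> {0..h}" for x t
    by (rule has_vector_derivative_within_subset[OF Fl1]) (use that h in auto)
  have Y: "((\<lambda>t. Y t z) has_vector_derivative M (Y t z)) (at t within {0..h})" if "t \<in> {0..h}" for z t
    by (rule has_vector_derivative_within_subset[OF Y2]) (use that h in auto)
  have E: "?E \<in> cball ?E (\<rho>/2)" using \<open>\<rho> > 0\<close> by auto
  have GE: "?G ?E = 0" by (simp add: control_field_def eq zero_prod_def)
  have Fl_E: "Fl t ?E = ?E" if "t \<in> {0..h}" for t
  proof -
    have "norm (Fl t ?E - ?E) \<le> 2 * (norm (Fl 0 ?E - ?E) + h1 * 0)"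
    proof (rule short_time_bound[where K = K and f' = "\<lambda>t. ?G (Fl t ?E)"])
      fix s assume s: "s \<in> {0..h1}"
      show "((\<lambda>a. Fl a ?E - ?E) has_vector_derivative ?G (Fl s ?E)) (at s within {0..h1})"
        using Fl1[OF E s] by (auto intro!: derivative_eq_intros)
      show "norm (?G (Fl s ?E)) \<le> 0 + K * norm (Fl s ?E - ?E)"
        using lipschitz_onD[OF lip Fl_in[OF E s], of ?E] GE \<open>\<rho> > 0\<close> by (simp add: dist_norm)
    qed (use that h h1 lipschitz_on_nonneg[OF lip] in auto)
    then show ?thesis by (simp add: Fl0[OF E])
  qed
  have Fl_der: "(Fl t has_derivative Y t) (at ?E)" if t: "t \<in> {0..h}" for t
  proof (rule flow_derivative_at_equilibrium[where h = h and \<rho> = "\<rho>/2" and G = ?G and M = M])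
    show "h * onorm M \<le> 1/2"
      using h h2 mult_right_mono[OF h(3) onorm_pos_le[OF \<open>bounded_linear M\<close>]] by linarith
    show "\<rho>/2 > 0" using \<open>\<rho> > 0\<close> by simp
    show "dist (Fl t x) (Fl t y) \<le> 2 * dist x y"
      if "x \<in> cball ?E (\<rho>/2)" "y \<in> cball ?E (\<rho>/2)" "t \<in> {0..h}" for x y t
      by (rule Fl_lip) (use that h in auto)
    show "bounded_linear (Y t)" if "t \<in> {0..h}" for t
      by (rule Y_lin) (use that h in auto)
  qed (fact h(1) Fl0 Fl Fl_E GE M Y0 Y t)+

  \<comment> \<open>\<open>R \<beta> t\<close> is the integral of
    \<open>exp (- s A) (B \<beta>)\<close> over \<open>s\<close> from 0 to \<open>t\<close>: the
    response to \<open>\<beta>\<close>, pulled back by the linear flow. The differential equation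
    avoids matrix exponentials.\<close>
  have "\<exists>R. R 0 = 0 \<and> (\<forall>t\<in>{0..h}. (R has_vector_derivative B \<beta> - A (R t)) (at t within {0..h}))" for \<beta>
  proof -
    have "(onorm A)-lipschitz_on UNIV (\<lambda>z. B \<beta> - A z)"
    proof (rule lipschitz_onI)
      show "dist (B \<beta> - A x) (B \<beta> - A y) \<le> onorm A * dist x y" for x y
        using onorm[OF A, of "y - x"] by (simp add: dist_norm A.diff norm_minus_commute)
    qed (rule nA)
    then show ?thesis
      using lipschitz_ivp[OF _ less_imp_le[OF h(1)] h(4), of "\<lambda>z. B \<beta> - A z" 0] by metis
  qed
  then obtain R where R0: "\<And>\<beta>. R \<beta> 0 = 0"
    and R: "\<And>\<beta> t. t \<in> {0..h} \<Longrightarrow> (R \<beta> has_vector_derivative B \<beta> - A (R \<beta> t)) (at t within {0..h})"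
    by metis
  \<comment> \<open>If the control \<open>- \<beta>\<close> brings \<open>w\<close> to 0 in time
    \<open>t\<close>, then the same curve run backwards leaves 0 and solves the equation of
    \<open>R \<beta>\<close>.\<close>
  have backward: "w = R \<beta> t" if t: "t \<in> {0..h}" and Yt: "fst (Y t (w, - \<beta>)) = 0" for w \<beta> t
  proof -
    have snd_Y: "snd (Y s (w, - \<beta>)) = - \<beta>" if "s \<in> {0..h}" for s
    proof -
      have "norm (snd (Y s (w, - \<beta>)) + \<beta>) \<le> 2 * (norm (snd (Y 0 (w, - \<beta>)) + \<beta>) + h * 0)"
        by (rule short_time_bound[where K = 0 and f' = "\<lambda>_. 0"])
           (use that Y[THEN has_vector_derivative_snd] in
             \<open>auto intro!: derivative_eq_intros simp: M_def case_prod_beta\<close>)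
      then show ?thesis by (simp add: Y0 eq_neg_iff_add_eq_0)
    qed
    let ?y = "\<lambda>s. fst (Y s (w, - \<beta>))"
    have y: "(?y has_vector_derivative A (?y s) - B \<beta>) (at s within {0..t})" if "s \<in> {0..t}" for s
    proof -
      have s: "s \<in> {0..h}" using that t by auto
      have "(?y has_vector_derivative A (?y s) - B \<beta>) (at s within {0..h})"
        using Y[OF s, THEN has_vector_derivative_fst, of "(w, - \<beta>)"] snd_Y[OF s]
        by (simp add: M_def case_prod_beta B.neg)
      then show ?thesis
        by (rule has_vector_derivative_within_subset) (use t in auto)
    qed
    have "norm (R \<beta> t - ?y (t - t)) \<le> 2 * (norm (R \<beta> 0 - ?y (t - 0)) + t * 0)"
    proof (rule short_time_bound[where K = "onorm A" and f' = "\<lambda>s. - A (R \<beta> s - ?y (t - s))"])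
      fix s assume s: "s \<in> {0..t}"
      have "((\<lambda>s. ?y (t - s)) has_vector_derivative - (A (?y (t - s)) - B \<beta>)) (at s within {0..t})"
        by (rule has_vector_derivative_reverse, rule y) (use s in auto)
      moreover have "(R \<beta> has_vector_derivative B \<beta> - A (R \<beta> s)) (at s within {0..t})"
        by (rule has_vector_derivative_within_subset[OF R]) (use s t in auto)
      ultimately show "((\<lambda>s. R \<beta> s - ?y (t - s)) has_vector_derivative - A (R \<beta> s - ?y (t - s)))
          (at s within {0..t})"
        by (auto intro!: derivative_eq_intros simp: A.diff)
      show "norm (- A (R \<beta> s - ?y (t - s))) \<le> 0 + onorm A * norm (R \<beta> s - ?y (t - s))"
        using onorm[OF A] by simp
    next
      show "t * onorm A \<le> 1/2"
        using mult_right_mono[of t h, OF _ nA] t h by auto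
    qed (use t nA in auto)
    then show ?thesis by (simp add: R0 Yt Y0)
  qed
  have R_0: "R 0 t = 0" if t: "t \<in> {0..h}" for t
  proof -
    have "Y t (0, - 0) = 0"
      using linear_0[OF bounded_linear.linear[OF Y_lin]] t h by (simp add: zero_prod_def[symmetric])
    then show ?thesis using backward[OF t, of 0 0] by simp
  qed

  \<comment> \<open>The parameters form a copy of the state space, so a family of deficient rank has
    a kernel direction to spare for one more control. Continuity on a ball is kept for the open
    mapping theorem at the end.\<close>
  define P where "P L \<longleftrightarrow> (\<exists>\<Psi> r. r > 0 \<and> continuous_on (ball 0 r) \<Psi> \<and> \<Psi> 0 = e \<and>
    (\<Psi> has_derivative L) (at 0) \<and> (\<forall>s\<in>ball 0 r. reach F e (\<Psi> s)))" for L :: "'a \<Rightarrow> 'a"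
  have "P (\<lambda>_. 0)"
    unfolding P_def
    by (rule exI[of _ "\<lambda>_. e"], rule exI[of _ 1]) (auto simp: reach_refl)
  moreover have "\<forall>L. P L \<longrightarrow> dim (range L) < Suc DIM('a)"
    by (simp add: dim_subset_UNIV less_Suc_eq_le)
  ultimately have "\<exists>L. P L \<and> (\<forall>L'. P L' \<longrightarrow> dim (range L') \<le> dim (range L))"
    by (rule Lattices_Big.ex_has_greatest_nat)
  then obtain L where L: "P L" and L_max: "\<And>L'. P L' \<Longrightarrow> dim (range L') \<le> dim (range L)"
    by blast
  obtain \<Psi> r where \<Psi>: "r > 0" "continuous_on (ball 0 r) \<Psi>" "\<Psi> 0 = e" "(\<Psi> has_derivative L) (at 0)"
    "\<And>s. s \<in> ball 0 r \<Longrightarrow> reach F e (\<Psi> s)"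
    using L unfolding P_def by blast
  have bL: "bounded_linear L" using \<Psi>(4) by (rule has_derivative_bounded_linear)
  then have linL: "linear L" by (rule bounded_linear.linear)
  have "surj L"
  proof (rule ccontr)
    assume "\<not> surj L"
    then have "\<not> inj L" using linL linear_injective_imp_surjective by blast
    then obtain \<eta> where \<eta>: "\<eta> \<noteq> 0" "L \<eta> = 0"
      using linear_injective_0[OF linL] by blast
    have R_in: "R \<beta> t \<in> range L" if t: "t \<in> {0..h}" for t \<beta>
    proof -
      define L' where "L' s = fst (Y t (L s, (\<eta> \<bullet> s) *\<^sub>R \<beta>))" for s
      define \<Psi>' where "\<Psi>' s = fst (Fl t (\<Psi> s, c0 + (\<eta> \<bullet> s) *\<^sub>R \<beta>))" for s
      have bY: "bounded_linear (Y t)" using Y_lin t h by auto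
      then have linY: "linear (Y t)" by (rule bounded_linear.linear)
      have \<Psi>_der: "((\<lambda>s. (\<Psi> s, c0 + (\<eta> \<bullet> s) *\<^sub>R \<beta>)) has_derivative (\<lambda>s. (L s, (\<eta> \<bullet> s) *\<^sub>R \<beta>))) (at 0)"
        using \<Psi>(4) by (auto intro!: derivative_eq_intros)
      have der': "(\<Psi>' has_derivative L') (at 0)"
      proof -
        have "(Fl t has_derivative Y t) (at (\<Psi> 0, c0 + (\<eta> \<bullet> 0) *\<^sub>R \<beta>))"
          using Fl_der[OF t] by (simp add: \<Psi>)
        from has_derivative_compose[OF \<Psi>_der this] show ?thesis
          unfolding \<Psi>'_def L'_def by (rule has_derivative_fst)
      qed
      have cont: "continuous_on (ball 0 r) (\<lambda>s. (\<Psi> s, c0 + (\<eta> \<bullet> s) *\<^sub>R \<beta>))"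
        by (intro continuous_intros \<Psi>)
      then have "isCont (\<lambda>s. (\<Psi> s, c0 + (\<eta> \<bullet> s) *\<^sub>R \<beta>)) 0"
        using \<open>r > 0\<close> by (simp add: continuous_on_eq_continuous_at)
      then obtain r' where "r' > 0"
        "\<And>s. dist s 0 < r' \<Longrightarrow> dist (\<Psi> s, c0 + (\<eta> \<bullet> s) *\<^sub>R \<beta>) (\<Psi> 0, c0 + (\<eta> \<bullet> 0) *\<^sub>R \<beta>) < \<rho>/2"
        using \<open>\<rho> > 0\<close> unfolding continuous_at_eps_delta by (meson half_gt_zero)
      then have r': "r' > 0"
        "\<And>s. s \<in> ball 0 r' \<Longrightarrow> (\<Psi> s, c0 + (\<eta> \<bullet> s) *\<^sub>R \<beta>) \<in> cball ?E (\<rho>/2)"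
        by (auto simp: \<Psi>(3) dist_commute less_imp_le)
      have "P L'"
        unfolding P_def
      proof (rule exI[of _ \<Psi>'], rule exI[of _ "min r r'"], intro conjI ballI)
        have "2-lipschitz_on (cball ?E (\<rho>/2)) (Fl t)"
          by (rule lipschitz_onI) (use Fl_lip t h in auto)
        then have "continuous_on (cball ?E (\<rho>/2)) (Fl t)"
          by (rule lipschitz_on_continuous_on)
        then show "continuous_on (ball 0 (min r r')) \<Psi>'"
          unfolding \<Psi>'_def
          by (intro continuous_on_fst continuous_on_compose2[OF _ continuous_on_subset[OF cont]])
             (use r' in auto)
        show "\<Psi>' 0 = e" by (simp add: \<Psi>'_def \<Psi> Fl_E[OF t])
        fix s :: 'a assume s: "s \<in> ball 0 (min r r')"
        then have in_ball: "(\<Psi> s, c0 + (\<eta> \<bullet> s) *\<^sub>R \<beta>) \<in> cball ?E (\<rho>/2)"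
          using r'(2) by simp
        then have "flow_maps (F (c0 + (\<eta> \<bullet> s) *\<^sub>R \<beta>)) t (\<Psi> s) (\<Psi>' s)"
          unfolding \<Psi>'_def by (intro control_flow(2)[of h] Fl[OF in_ball] Fl0[OF in_ball] t)
        then have "reach F (\<Psi> s) (\<Psi>' s)"
          using t by (intro flow_maps_imp_reach) auto
        then show "reach F e (\<Psi>' s)"
          using \<Psi>(5)[of s] s reach_trans by auto
      qed (use \<open>r > 0\<close> r' der' in auto)
      then have dim_le: "dim (range L') \<le> dim (range L)" by (rule L_max)
      let ?S = "\<lambda>z. fst (Y t (z, 0))"
      have linS: "linear ?S"
        by (rule linearI)
           (use linear_add[OF linY, of "(_, 0)" "(_, 0)"] linear_scale[OF linY, of _ "(_, 0)"] in auto)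
      \<comment> \<open>By \<open>backward\<close> with \<open>\<beta> = 0\<close>, a state that the
        uncontrolled linear flow brings to 0 equals \<open>R 0 t\<close>, which is 0.\<close>
      have "inj ?S"
        unfolding linear_injective_0[OF linS]
        using backward[OF t, of _ 0] R_0[OF t] by auto
      have linL': "linear L'"
        using der' has_derivative_bounded_linear bounded_linear.linear by blast
      have dim_S: "dim (?S ` range L) = dim (range L)"
        by (rule dim_image_eq[OF linS]) (use \<open>inj ?S\<close> inj_on_subset in blast)
      have "?S ` range L = range L'"
      proof (rule subspace_dim_equal)
        show "subspace (?S ` range L)" "subspace (range L')"
          using linS linL linL' by (auto intro!: linear_subspace_image)
        show "dim (range L') \<le> dim (?S ` range L)"
          using dim_S dim_le by simp
        show "?S ` range L \<subseteq> range L'"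
        proof safe
          fix s
          \<comment> \<open>Dropping the component along \<open>\<eta>\<close> leaves
            \<open>L s\<close> unchanged and switches the added control off. So the transported old
            range survives in the range of \<open>L'\<close>, and maximal rank forces
            equality.\<close>
          let ?s = "s - ((\<eta> \<bullet> s) / (\<eta> \<bullet> \<eta>)) *\<^sub>R \<eta>"
          have "L ?s = L s" using \<eta> linL by (simp add: linear_diff linear_scale)
          moreover have "\<eta> \<bullet> ?s = 0" using \<eta> by (simp add: inner_diff_right)
          ultimately have "L' ?s = ?S (L s)" by (simp add: L'_def)
          then show "?S (L s) \<in> range L'" by (metis rangeI)
        qed
      qed
      \<comment> \<open>In this direction \<open>L\<close> vanishes and the control deviates by
        exactly \<open>\<beta>\<close>.\<close>
      moreover have "L' ((1 / (\<eta> \<bullet> \<eta>)) *\<^sub>R \<eta>) = fst (Y t (0, \<beta>))"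
        using \<eta> linL by (simp add: L'_def linear_scale)
      ultimately have "fst (Y t (0, \<beta>)) \<in> ?S ` range L" by (metis rangeI)
      then obtain w where w: "w \<in> range L" "fst (Y t (0, \<beta>)) = ?S w" by blast
      have "fst (Y t (w, - \<beta>)) = 0"
        using linear_diff[OF linY, of "(w, 0)" "(0, \<beta>)"] w(2) by simp
      then show ?thesis using backward[OF t] w(1) by metis
    qed
    have "dim (range L) < DIM('a)"
    proof (rule ccontr)
      assume "\<not> ?thesis"
      then have "range L = UNIV"
        by (intro subspace_dim_equal) (use linL in \<open>auto intro!: linear_subspace_image\<close>)
      then show False using \<open>\<not> surj L\<close> by simp
    qed
    then obtain \<xi> where \<xi>: "\<xi> \<noteq> 0" "\<And>v. v \<in> span (range L) \<Longrightarrow> orthogonal \<xi> v"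
      using orthogonal_to_subspace_exists by blast
    have "\<xi> \<bullet> (A ^^ k) (B \<beta>) = 0" for k \<beta>
    proof -
      have lin_k: "bounded_linear (A ^^ k)" for k
        by (induction k) (auto intro: bounded_linear_compose[OF A] bounded_linear_ident simp: id_def comp_def)
      have deriv0: "\<xi> \<bullet> (A ^^ k) (B \<beta> - A (R \<beta> t)) = 0"
        if zero: "\<And>t. t \<in> {0..h} \<Longrightarrow> \<xi> \<bullet> (A ^^ k) (R \<beta> t) = 0" and t: "t \<in> {0..h}" for k t
      proof (rule vector_derivative_unique_within)
        have "bounded_linear (\<lambda>z. \<xi> \<bullet> (A ^^ k) z)"
          by (rule bounded_linear_compose[OF bounded_linear_inner_right lin_k])
        from bounded_linear.has_vector_derivative[OF this R[OF t]]
        show "((\<lambda>t. \<xi> \<bullet> (A ^^ k) (R \<beta> t)) has_vector_derivative \<xi> \<bullet> (A ^^ k) (B \<beta> - A (R \<beta> t)))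
            (at t within {0..h})" .
        show "((\<lambda>t. \<xi> \<bullet> (A ^^ k) (R \<beta> t)) has_vector_derivative 0) (at t within {0..h})"
          by (rule has_vector_derivative_transform[OF t _ has_vector_derivative_const[of 0]])
             (use zero in auto)
        show "at t within {0..h} \<noteq> bot"
          using t h by (simp add: trivial_limit_within islimpt_Icc)
      qed
      \<comment> \<open>Differentiating the statement for \<open>k\<close> equates
        \<open>\<xi> \<bullet> (A ^^ k) (B \<beta>)\<close> with
        \<open>\<xi> \<bullet> (A ^^ Suc k) (R \<beta> t)\<close>. The latter is 0 at time 0, so
        both vanish throughout: this is the statement for \<open>Suc k\<close>.\<close>
      have zero: "\<forall>t\<in>{0..h}. \<xi> \<bullet> (A ^^ k) (R \<beta> t) = 0" for k
      proof (induction k)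
        case 0
        show ?case
          using \<xi>(2)[OF span_base[OF R_in]] by (simp add: orthogonal_def)
      next
        case (Suc k)
        have *: "\<xi> \<bullet> (A ^^ k) (B \<beta> - A (R \<beta> t)) = 0" if "t \<in> {0..h}" for t
          using deriv0 Suc that by blast
        have "\<xi> \<bullet> (A ^^ k) (B \<beta>) = 0"
          using *[of 0] h by (simp add: R0 A.zero)
        then show ?case
          using * bounded_linear.linear[OF lin_k, THEN linear_diff]
          by (simp add: inner_diff_right funpow_Suc_right del: funpow.simps)
      qed
      show ?thesis
        using deriv0[of k 0] zero[of k] h by (simp add: R0 A.zero)
    qed
    then show False using kalman \<xi>(1) by blast
  qed
  then obtain L' where L': "linear L'" "L \<circ> L' = id"
    using linear_surjective_right_inverse[OF linL] by blast
  \<comment> \<open>\<open>\<Psi>\<close> is known to be differentiable at 0 only, which rules out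
    the inverse function theorem; this open mapping theorem combines continuity with a surjective
    derivative at one point.\<close>
  have "\<Psi> 0 \<in> interior (\<Psi> ` ball 0 r)"
    by (rule sussmann_open_mapping[OF open_ball \<Psi>(2) _ \<Psi>(4) _ L'(2)])
       (use \<open>r > 0\<close> L' linear_conv_bounded_linear in auto)
  then obtain d where "d > 0" "ball e d \<subseteq> \<Psi> ` ball 0 r"
    by (auto simp: mem_interior \<Psi>)
  then show ?thesis
    using \<Psi>(5) by blast
qed

section \<open>Approximate reachability\<close>

text \<open>Approximate reachability that is stable under perturbations of the initial point. Unlike the
  closure of the reachable set it is transitive without any continuity of long flows.\<close>

definition approx_reach :: "('c \<Rightarrow> 'a::real_normed_vector \<Rightarrow> 'a) \<Rightarrow> 'a \<Rightarrow> 'a \<Rightarrow> bool" where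
  "approx_reach F x y \<longleftrightarrow>
     (\<forall>\<epsilon>>0. \<exists>\<delta>>0. \<forall>x'. dist x' x < \<delta> \<longrightarrow> (\<exists>y'. dist y' y < \<epsilon> \<and> reach F x' y'))"

lemma approx_reach_refl: "approx_reach F x x"
  unfolding approx_reach_def using reach_refl by blast

lemma approx_reach_trans:
  assumes "approx_reach F x y" "approx_reach F y z"
  shows "approx_reach F x z"
  unfolding approx_reach_def
proof (intro allI impI)
  fix \<epsilon> :: real assume "\<epsilon> > 0"
  then obtain \<delta>1 where 1: "\<delta>1 > 0" "\<forall>y'. dist y' y < \<delta>1 \<longrightarrow> (\<exists>z'. dist z' z < \<epsilon> \<and> reach F y' z')"
    using assms(2) unfolding approx_reach_def by blast
  then obtain \<delta> where 2: "\<delta> > 0" "\<forall>x'. dist x' x < \<delta> \<longrightarrow> (\<exists>y'. dist y' y < \<delta>1 \<and> reach F x' y')"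
    using assms(1) unfolding approx_reach_def by blast
  show "\<exists>\<delta>>0. \<forall>x'. dist x' x < \<delta> \<longrightarrow> (\<exists>z'. dist z' z < \<epsilon> \<and> reach F x' z')"
    using 1 2 by (metis reach_trans)
qed

lemma closed_approx_reach: "closed {y. approx_reach F x y}"
  unfolding closure_subset_eq[symmetric]
proof
  fix y assume "y \<in> closure {y. approx_reach F x y}"
  then have y: "\<forall>e>0. \<exists>z\<in>{y. approx_reach F x y}. dist z y < e"
    by (simp only: closure_approachable)
  have "approx_reach F x y"
    unfolding approx_reach_def
  proof (intro allI impI)
    fix \<epsilon> :: real assume \<epsilon>: "\<epsilon> > 0"
    then obtain z where z: "approx_reach F x z" "dist z y < \<epsilon>/2"
      using y by (metis half_gt_zero mem_Collect_eq)
    obtain \<delta> where \<delta>: "\<delta> > 0" "\<forall>x'. dist x' x < \<delta> \<longrightarrow> (\<exists>y'. dist y' z < \<epsilon>/2 \<and> reach F x' y')"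
      using z(1) \<epsilon> unfolding approx_reach_def by (meson half_gt_zero)
    show "\<exists>\<delta>>0. \<forall>x'. dist x' x < \<delta> \<longrightarrow> (\<exists>y'. dist y' y < \<epsilon> \<and> reach F x' y')"
    proof (intro exI[of _ \<delta>] conjI allI impI)
      fix x' assume "dist x' x < \<delta>"
      then obtain y' where "dist y' z < \<epsilon>/2" "reach F x' y'" using \<delta> by blast
      then show "\<exists>y'. dist y' y < \<epsilon> \<and> reach F x' y'"
        using z(2) dist_triangle[of y' y z] by (intro exI[of _ y']) auto
    qed (use \<delta> in auto)
  qed
  then show "y \<in> {y. approx_reach F x y}" by simp
qed

text \<open>Short flows are 2-Lipschitz in the initial point, hence stable under its perturbation.
  The whole curve is returned, since minimality of the energy will be tested along it.\<close>

lemma approx_reach_constant_control: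
  fixes F :: "'c::euclidean_space \<Rightarrow> 'a::euclidean_space \<Rightarrow> 'a"
  assumes lip: "\<exists>K. K-lipschitz_on (cball (x, c) 1) (control_field F)"
  obtains h \<gamma> where "h > 0" "\<gamma> 0 = x"
    "\<And>t. t \<in> {0..h} \<Longrightarrow> (\<gamma> has_vector_derivative F c (\<gamma> t)) (at t within {0..h})"
    "\<And>t. t \<in> {0..h} \<Longrightarrow> approx_reach F x (\<gamma> t)"
proof -
  obtain K where K: "K-lipschitz_on (cball (x, c) 1) (control_field F)" using lip by blast
  obtain h Fl where h: "h > 0"
    and Fl0: "\<And>z. z \<in> cball (x, c) (1/2) \<Longrightarrow> Fl 0 z = z"
    and Fl: "\<And>z t. z \<in> cball (x, c) (1/2) \<Longrightarrow> t \<in> {0..h} \<Longrightarrow>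
       ((\<lambda>t. Fl t z) has_vector_derivative control_field F (Fl t z)) (at t within {0..h})"
    and Fl_lip: "\<And>y z t. y \<in> cball (x, c) (1/2) \<Longrightarrow> z \<in> cball (x, c) (1/2) \<Longrightarrow> t \<in> {0..h} \<Longrightarrow>
       dist (Fl t y) (Fl t z) \<le> 2 * dist y z"
    by (rule local_flow[OF K zero_less_one]) (rule that; assumption)
  have ball: "(x', c) \<in> cball (x, c) (1/2)" if "dist x' x \<le> 1/2" for x'
    using that by (simp add: dist_Pair_Pair dist_commute)
  have x: "(x, c) \<in> cball (x, c) (1/2)" by simp
  let ?\<gamma> = "\<lambda>t. fst (Fl t (x, c))"
  show ?thesis
  proof (rule that[of h ?\<gamma>])
    fix t assume t: "t \<in> {0..h}"
    have "snd (Fl t (x, c)) = c"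
      by (rule control_flow(1)[where h = h and F = F and Fl = Fl and x = x and c = c, OF _ Fl0[OF x] t]) (rule Fl[OF x])
    then show "(?\<gamma> has_vector_derivative F c (?\<gamma> t)) (at t within {0..h})"
      using Fl[OF x t, THEN has_vector_derivative_fst] by (simp add: control_field_def case_prod_beta)
    show "approx_reach F x (?\<gamma> t)"
      unfolding approx_reach_def
    proof (intro allI impI)
      fix \<epsilon> :: real assume "\<epsilon> > 0"
      show "\<exists>\<delta>>0. \<forall>x'. dist x' x < \<delta> \<longrightarrow> (\<exists>y'. dist y' (?\<gamma> t) < \<epsilon> \<and> reach F x' y')"
      proof (intro exI[of _ "min (1/2) (\<epsilon>/2)"] conjI allI impI)
        fix x' assume x': "dist x' x < min (1/2) (\<epsilon>/2)"
        then have b: "(x', c) \<in> cball (x, c) (1/2)" by (intro ball) auto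
        have "dist (fst (Fl t (x', c))) (?\<gamma> t) \<le> dist (Fl t (x', c)) (Fl t (x, c))"
          by (rule dist_fst_le)
        also have "\<dots> \<le> 2 * dist x' x"
          using Fl_lip[OF b x t] by (simp add: dist_Pair_Pair)
        finally have "dist (fst (Fl t (x', c))) (?\<gamma> t) < \<epsilon>" using x' by simp
        moreover have "reach F x' (fst (Fl t (x', c)))"
        proof (rule flow_maps_imp_reach)
          show "flow_maps (F c) t x' (fst (Fl t (x', c)))"
            by (rule control_flow(2)[where h = h and F = F and Fl = Fl and x = x' and c = c, OF _ Fl0[OF b] t]) (rule Fl[OF b])
        qed (use t in auto)
        ultimately show "\<exists>y'. dist y' (?\<gamma> t) < \<epsilon> \<and> reach F x' y'" by blast
      qed (use \<open>\<epsilon> > 0\<close> in auto)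
    qed
  qed (use h Fl0[OF x] in auto)
qed

text \<open>A control of size \<open>m\<close> acting for the time \<open>1/m\<close> moves the state along the controlled
  direction, while the drift contributes only \<open>O(1/m)\<close>.\<close>

lemma approx_reach_impulse:
  fixes F :: "'c \<Rightarrow> 'a::euclidean_space \<Rightarrow> 'a" and cc :: "real \<Rightarrow> 'c"
  assumes F: "\<And>r x. F (cc r) x = f x + r *\<^sub>R g"
    and lip: "\<And>\<rho>. \<exists>K. K-lipschitz_on (cball x \<rho>) f"
  shows "approx_reach F x (x + s *\<^sub>R g)"
  unfolding approx_reach_def
proof (intro allI impI)
  fix \<epsilon> :: real assume "\<epsilon> > 0"
  define \<epsilon>' where "\<epsilon>' = min (1/2) (\<epsilon>/2)"
  have \<epsilon>': "\<epsilon>' > 0" "\<epsilon>' \<le> 1/2" "\<epsilon>' \<le> \<epsilon>/2" using \<open>\<epsilon> > 0\<close> by (auto simp: \<epsilon>'_def)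
  \<comment> \<open>The 1 leaves room for two errors of at most \<open>\<epsilon>'\<close>: the
    shift of the initial point and the effect of the drift.\<close>
  let ?D = "cball x (norm (s *\<^sub>R g) + 1)"
  have D: "convex ?D" "closed ?D" "?D \<noteq> {}"
    using norm_ge_zero[of "s *\<^sub>R g"] by (auto simp del: norm_scaleR norm_ge_zero)
  obtain K where K: "K-lipschitz_on ?D f" using lip by blast
  have "0 \<le> K" using K lipschitz_on_nonneg by blast
  have "compact (f ` ?D)"
    by (intro compact_continuous_image lipschitz_on_continuous_on[OF K]) auto
  then obtain b where b: "b > 0" "\<And>z. z \<in> ?D \<Longrightarrow> norm (f z) \<le> b"
    using compact_imp_bounded bounded_pos by (metis imageI)
  \<comment> \<open>The terms give, in order, the contraction bound \<open>K / m \<le> 1/2\<close>,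
    a drift contribution of at most \<open>\<epsilon>'\<close>, and \<open>m > 0\<close>.\<close>
  define m where "m = 2 * K + b / \<epsilon>' + 1"
  have m: "m > 0" "K / m \<le> 1/2" "b / m \<le> \<epsilon>'"
    using \<open>0 \<le> K\<close> b \<epsilon>' by (auto simp: m_def field_simps add_pos_nonneg add_nonneg_pos)
  \<comment> \<open>The controlled field after stretching time by \<open>m\<close>, so that the
    impulse takes unit time; \<open>f\<close> is cut off outside \<open>?D\<close>.\<close>
  define T where "T z = (1/m) *\<^sub>R f (closest_point ?D z) + s *\<^sub>R g" for z
  have "(K/m)-lipschitz_on UNIV T"
  proof (rule lipschitz_onI)
    fix y z
    have "dist (T y) (T z) = (1/m) * dist (f (closest_point ?D y)) (f (closest_point ?D z))"
      using m by (simp add: T_def dist_norm scaleR_diff_right[symmetric])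
    also have "\<dots> \<le> (1/m) * (K * dist (closest_point ?D y) (closest_point ?D z))"
      by (intro mult_left_mono lipschitz_onD[OF K] closest_point_in_set D) (use m in auto)
    also have "\<dots> \<le> (1/m) * (K * dist y z)"
      by (intro mult_left_mono closest_point_lipschitz D) (use m \<open>0 \<le> K\<close> in auto)
    finally show "dist (T y) (T z) \<le> K / m * dist y z" by simp
  qed (use m \<open>0 \<le> K\<close> in auto)
  then have sol: "\<exists>\<gamma>. \<gamma> 0 = x' \<and> (\<forall>t\<in>{0..1}. (\<gamma> has_vector_derivative T (\<gamma> t)) (at t within {0..1}))" for x'
    using m(2) by (metis lipschitz_ivp mult_1 zero_le_one)
  show "\<exists>\<delta>>0. \<forall>x'. dist x' x < \<delta> \<longrightarrow> (\<exists>y'. dist y' (x + s *\<^sub>R g) < \<epsilon> \<and> reach F x' y')"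
  proof (intro exI[of _ \<epsilon>'] conjI allI impI)
    fix x' assume x': "dist x' x < \<epsilon>'"
    obtain \<gamma> where \<gamma>: "\<gamma> 0 = x'" "\<And>t. t \<in> {0..1} \<Longrightarrow> (\<gamma> has_vector_derivative T (\<gamma> t)) (at t within {0..1})"
      using sol[of x'] by blast
    have near: "norm (\<gamma> t - (x' + t *\<^sub>R s *\<^sub>R g)) \<le> \<epsilon>'" if t: "t \<in> {0..1}" for t
    proof -
      have "norm ((\<gamma> t - t *\<^sub>R s *\<^sub>R g) - (\<gamma> 0 - 0 *\<^sub>R s *\<^sub>R g)) \<le> \<epsilon>' * norm (t - 0)"
      proof (rule differentiable_bound[of "{0..1}"])
        fix t :: real assume t: "t \<in> {0..1}"
        have "((\<lambda>t. \<gamma> t - t *\<^sub>R s *\<^sub>R g) has_vector_derivative (1/m) *\<^sub>R f (closest_point ?D (\<gamma> t))) (at t within {0..1})"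
          using \<gamma>(2)[OF t] by (auto intro!: derivative_eq_intros simp: T_def)
        then show "((\<lambda>t. \<gamma> t - t *\<^sub>R s *\<^sub>R g) has_derivative (\<lambda>u. u *\<^sub>R ((1/m) *\<^sub>R f (closest_point ?D (\<gamma> t))))) (at t within {0..1})"
          by (simp add: has_vector_derivative_def)
        have "norm (f (closest_point ?D (\<gamma> t))) \<le> b"
          by (rule b(2)) (rule closest_point_in_set[OF D(2,3)])
        then have "norm ((1/m) *\<^sub>R f (closest_point ?D (\<gamma> t))) \<le> b / m"
          using m by (simp add: divide_right_mono)
        then show "onorm (\<lambda>u. u *\<^sub>R ((1/m) *\<^sub>R f (closest_point ?D (\<gamma> t)))) \<le> \<epsilon>'"
          using m(3) by (simp only: onorm_scaleR_left[OF bounded_linear_ident] onorm_id)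
      qed (use t in auto)
      also have "\<dots> \<le> \<epsilon>'" using t \<epsilon>' by (simp add: mult_left_le)
      finally show ?thesis by (simp add: \<gamma> algebra_simps)
    qed
    have in_D: "\<gamma> t \<in> ?D" if t: "t \<in> {0..1}" for t
    proof -
      have "norm (t *\<^sub>R s *\<^sub>R g) \<le> norm (s *\<^sub>R g)"
        using t mult_right_mono[of t 1 "norm (s *\<^sub>R g)"] by (simp add: abs_mult mult.assoc)
      moreover have "norm (\<gamma> t - x) \<le> norm (\<gamma> t - (x' + t *\<^sub>R s *\<^sub>R g)) + norm (x' - x) + norm (t *\<^sub>R s *\<^sub>R g)"
        using norm_triangle_ineq[of "\<gamma> t - (x' + t *\<^sub>R s *\<^sub>R g) + (x' - x)" "t *\<^sub>R s *\<^sub>R g"]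
          norm_triangle_ineq[of "\<gamma> t - (x' + t *\<^sub>R s *\<^sub>R g)" "x' - x"] by simp
      ultimately have "norm (\<gamma> t - x) \<le> norm (s *\<^sub>R g) + 1"
        using near[OF t] x' \<epsilon>' by (simp add: dist_norm)
      then show ?thesis by (simp add: dist_norm norm_minus_commute)
    qed
    have "flow_maps (F (cc (m * s))) (1/m) x' (\<gamma> 1)"
      unfolding flow_maps_def
    proof (intro exI[of _ "\<lambda>t. \<gamma> (m * t)"] conjI ballI)
      fix t assume t: "t \<in> {0..1/m}"
      then have mt: "m * t \<in> {0..1}" using m by (auto simp: field_simps)
      have "((\<lambda>t. m * t) has_vector_derivative m) (at t within {0..1/m})"
        by (auto intro!: derivative_eq_intros)
      moreover have "(\<lambda>t. m * t) ` {0..1/m} \<subseteq> {0..1}"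
        using m by (auto simp: field_simps)
      then have "(\<gamma> has_vector_derivative T (\<gamma> (m * t))) (at (m * t) within (\<lambda>t. m * t) ` {0..1/m})"
        using \<gamma>(2)[OF mt] by (rule has_vector_derivative_within_subset[rotated])
      ultimately have "((\<lambda>t. \<gamma> (m * t)) has_vector_derivative m *\<^sub>R T (\<gamma> (m * t))) (at t within {0..1/m})"
        using vector_diff_chain_within[of "\<lambda>t. m * t"] by (simp add: comp_def)
      moreover have "m *\<^sub>R T (\<gamma> (m * t)) = F (cc (m * s)) (\<gamma> (m * t))"
        using m closest_point_self[OF in_D[OF mt]] by (simp add: T_def F scaleR_add_right)
      ultimately show "((\<lambda>t. \<gamma> (m * t)) has_vector_derivative F (cc (m * s)) (\<gamma> (m * t))) (at t within {0..1/m})"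
        by simp
    qed (use \<gamma> m in auto)
    then have "reach F x' (\<gamma> 1)"
      using m by (intro flow_maps_imp_reach) auto
    moreover have "dist (\<gamma> 1) (x + s *\<^sub>R g) \<le> norm (\<gamma> 1 - (x' + s *\<^sub>R g)) + norm (x' - x)"
      using norm_triangle_ineq[of "\<gamma> 1 - (x' + s *\<^sub>R g)" "x' - x"]
      by (simp add: dist_norm diff_diff_eq add.commute)
    then have "dist (\<gamma> 1) (x + s *\<^sub>R g) < \<epsilon>"
      using near[of 1] x' \<epsilon>' by (simp add: dist_norm)
    ultimately show "\<exists>y'. dist y' (x + s *\<^sub>R g) < \<epsilon> \<and> reach F x' y'" by blast
  qed (use \<epsilon>' in auto)
qed

lemma zero_function_derivative:
  fixes f :: "real \<Rightarrow> 'a::real_normed_vector"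
  assumes "(f has_vector_derivative f') (at t within {0..h})" and "t \<in> {0..h}" "h > 0"
    and const: "\<And>s. s \<in> {0..h} \<Longrightarrow> f s = c"
  shows "f' = 0"
proof (rule vector_derivative_unique_within[OF _ assms(1)])
  show "(f has_vector_derivative 0) (at t within {0..h})"
    by (rule has_vector_derivative_transform[OF assms(2) _ has_vector_derivative_const[of c]])
       (rule const)
  show "at t within {0..h} \<noteq> bot"
    using assms by (simp add: trivial_limit_within islimpt_Icc)
qed

section \<open>The chain of particles\<close>

lemma particle_eq_iff:
  assumes "j \<in> {1..CARD('n)}" "k \<in> {1..CARD('n)}"
  shows "(particle j :: 'n::{finite,linorder}) = particle k \<longleftrightarrow> j = k"
  using inj_on_eq_iff[OF bij_betw_imp_inj_on[OF bij_betw_particle[where 'n = 'n]]] assms by blast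

lemma sum_particle:
  "(\<Sum>i\<in>UNIV. f (i :: 'n::{finite,linorder})) = (\<Sum>k=1..CARD('n). f (particle k))"
  using sum.reindex_bij_betw[OF bij_betw_particle[where 'n = 'n], of f] by simp

lemma bounded_linear_q_coord: "bounded_linear (\<lambda>x. q_coord x k)"
  unfolding q_coord_def
  by (rule bounded_linear_compose[OF bounded_linear_vec_nth bounded_linear_fst])

lemma bounded_linear_p_coord: "bounded_linear (\<lambda>x. p_coord x k)"
  unfolding p_coord_def
  by (rule bounded_linear_compose[OF bounded_linear_vec_nth bounded_linear_snd])

lemmas q_coord_linear [simp] =
  linear_add[OF bounded_linear.linear[OF bounded_linear_q_coord]]
  linear_diff[OF bounded_linear.linear[OF bounded_linear_q_coord]]
  linear_scale[OF bounded_linear.linear[OF bounded_linear_q_coord], unfolded real_scaleR_def]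
  linear_sum[OF bounded_linear.linear[OF bounded_linear_q_coord]]
  linear_0[OF bounded_linear.linear[OF bounded_linear_q_coord]]

lemmas p_coord_linear [simp] =
  linear_add[OF bounded_linear.linear[OF bounded_linear_p_coord]]
  linear_diff[OF bounded_linear.linear[OF bounded_linear_p_coord]]
  linear_scale[OF bounded_linear.linear[OF bounded_linear_p_coord], unfolded real_scaleR_def]
  linear_sum[OF bounded_linear.linear[OF bounded_linear_p_coord]]
  linear_0[OF bounded_linear.linear[OF bounded_linear_p_coord]]

lemma coord_basis:
  assumes "j \<in> {1..CARD('n)}" "k \<in> {1..CARD('n)}"
  shows "q_coord (d_dq j :: 'n::{finite,linorder} state) k = (if j = k then 1 else 0)"
    and "p_coord (d_dp j :: 'n state) k = (if j = k then 1 else 0)"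
  using particle_eq_iff[OF assms] by (auto simp: q_coord_def p_coord_def d_dq_def d_dp_def axis_def)

lemma coord_basis_mixed [simp]: "q_coord (d_dp j) k = 0" "p_coord (d_dq j) k = 0"
  by (simp_all add: q_coord_def p_coord_def d_dq_def d_dp_def)

lemma inner_basis:
  "x \<bullet> d_dq k = q_coord x k" "x \<bullet> d_dp k = p_coord x k"
  by (simp_all add: inner_prod_def d_dq_def d_dp_def q_coord_def p_coord_def inner_axis)

lemma state_eqI:
  fixes x y :: "'n::{finite,linorder} state"
  assumes "\<And>k. k \<in> {1..CARD('n)} \<Longrightarrow> q_coord x k = q_coord y k"
    and "\<And>k. k \<in> {1..CARD('n)} \<Longrightarrow> p_coord x k = p_coord y k"
  shows "x = y"
proof -
  have *: "\<exists>k\<in>{1..CARD('n)}. i = particle k" for i :: 'n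
    using bij_betw_imp_surj_on[OF bij_betw_particle[where 'n = 'n]] by blast
  have "fst x $ i = fst y $ i \<and> snd x $ i = snd y $ i" for i
  proof -
    obtain k where "k \<in> {1..CARD('n)}" "i = particle k" using * by blast
    then show ?thesis
      using assms[of k] by (simp add: q_coord_def p_coord_def)
  qed
  then show ?thesis by (simp add: prod_eq_iff vec_eq_iff)
qed

text \<open>Summation by parts: forces are collected by bonds instead of particles, each bond
  pushing its two ends in opposite directions. The end particles then need no separate
  terms.\<close>

lemma sum_bond_form:
  fixes a :: "nat \<Rightarrow> real" and d :: "nat \<Rightarrow> 'a::real_vector"
  assumes "n \<ge> 2"
  shows "- a 1 *\<^sub>R d 1 + (\<Sum>k=2..n-1. (a (k - 1) - a k) *\<^sub>R d k) + a (n - 1) *\<^sub>R d n =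
    (\<Sum>k=1..<n. a k *\<^sub>R (d (k + 1) - d k))"
  using assms
proof (induction n rule: nat_induct_at_least)
  case base
  show ?case by (simp add: scaleR_diff_right numeral_2_eq_2)
next
  case (Suc n)
  define S where "S = (\<Sum>k=2..n-1. (a (k - 1) - a k) *\<^sub>R d k)"
  have "{2..Suc n - 1} = insert n {2..n - 1}" "n \<notin> {2..n - 1}" using Suc.hyps by auto
  then have sum: "(\<Sum>k=2..Suc n-1. (a (k - 1) - a k) *\<^sub>R d k) = (a (n - 1) - a n) *\<^sub>R d n + S"
    by (simp add: S_def)
  have "(\<Sum>k=1..<Suc n. a k *\<^sub>R (d (k + 1) - d k)) =
      (\<Sum>k=1..<n. a k *\<^sub>R (d (k + 1) - d k)) + a n *\<^sub>R (d (n + 1) - d n)"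
    using Suc.hyps by simp
  also have "\<dots> = - a 1 *\<^sub>R d 1 + S + a (n - 1) *\<^sub>R d n + a n *\<^sub>R (d (n + 1) - d n)"
    unfolding S_def Suc.IH ..
  also have "\<dots> = - a 1 *\<^sub>R d 1 + ((a (n - 1) - a n) *\<^sub>R d n + S) + a n *\<^sub>R d (Suc n)"
    by (simp add: scaleR_diff_left scaleR_diff_right)
  finally show ?case
    unfolding sum by simp
qed

lemma double_forced_bond_form:
  fixes x :: "'n::{finite,linorder} state"
  assumes "CARD('n) \<ge> 2"
  shows "double_forced \<phi> c x =
    (\<Sum>k=1..CARD('n). p_coord x k *\<^sub>R d_dq k)
    + (\<Sum>k=1..<CARD('n). \<phi> (q_coord x k - q_coord x (k + 1)) *\<^sub>R (d_dp (k + 1) - d_dp k))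
    + fst c *\<^sub>R d_dp 1 + snd c *\<^sub>R d_dp CARD('n)"
proof -
  define a where "a k = \<phi> (q_coord x k - q_coord x (k + 1))" for k
  have "(\<Sum>k=2..CARD('n)-1. (\<phi> (q_coord x (k - 1) - q_coord x k) - \<phi> (q_coord x k - q_coord x (k + 1))) *\<^sub>R (d_dp k :: 'n state)) =
    (\<Sum>k=2..CARD('n)-1. (a (k - 1) - a k) *\<^sub>R d_dp k)"
    by (rule sum.cong) (auto simp: a_def)
  moreover have "\<phi> (q_coord x 1 - q_coord x 2) = a 1"
    "\<phi> (q_coord x (CARD('n) - 1) - q_coord x CARD('n)) = a (CARD('n) - 1)"
    using assms by (simp_all add: a_def numeral_2_eq_2)
  ultimately have "drift \<phi> x = (\<Sum>k=1..CARD('n). p_coord x k *\<^sub>R d_dq k)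
      + (- a 1 *\<^sub>R d_dp 1 + (\<Sum>k=2..CARD('n)-1. (a (k - 1) - a k) *\<^sub>R d_dp k)
      + a (CARD('n) - 1) *\<^sub>R d_dp CARD('n))"
    unfolding drift_def Let_def by simp
  then show ?thesis
    unfolding sum_bond_form[OF assms] by (simp add: double_forced_def a_def)
qed

lemma q_coord_double_forced:
  fixes x :: "'n::{finite,linorder} state"
  assumes "CARD('n) \<ge> 2" and k: "k \<in> {1..CARD('n)}"
  shows "q_coord (double_forced \<phi> c x) k = p_coord x k"
proof -
  have "q_coord (double_forced \<phi> c x) k = (\<Sum>j=1..CARD('n). p_coord x j * q_coord (d_dq j :: 'n state) k)"
    unfolding double_forced_bond_form[OF assms(1)] by simp
  also have "\<dots> = (\<Sum>j=1..CARD('n). if j = k then p_coord x j else 0)"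
    by (rule sum.cong) (use k in \<open>auto simp: coord_basis\<close>)
  finally show ?thesis using k by simp
qed

text \<open>In this form the controls look like the forces of two more bonds, \<open>fst c\<close>
  before the first particle and \<open>- snd c\<close> behind the last, so one balance of forces
  serves all particles.\<close>

lemma p_coord_double_forced:
  fixes x :: "'n::{finite,linorder} state"
  assumes "CARD('n) \<ge> 2" and k: "k \<in> {1..CARD('n)}"
  shows "p_coord (double_forced \<phi> c x) k =
    (if k > 1 then \<phi> (q_coord x (k - 1) - q_coord x k) else fst c)
    - (if k < CARD('n) then \<phi> (q_coord x k - q_coord x (k + 1)) else - snd c)"
proof -
  let ?a = "\<lambda>k. \<phi> (q_coord x k - q_coord x (k + 1))"
  have "(\<Sum>j=1..<CARD('n). ?a j * p_coord (d_dp (j + 1) - d_dp j :: 'n state) k) =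
      (\<Sum>j=1..<CARD('n). (if j = k - 1 then ?a j else 0) - (if j = k then ?a j else 0))"
    by (rule sum.cong) (use k in \<open>auto simp: coord_basis\<close>)
  also have "\<dots> = (if k > 1 then ?a (k - 1) else 0) - (if k < CARD('n) then ?a k else 0)"
    using k by (auto simp: sum_subtractf sum.delta')
  finally have bonds: "(\<Sum>j=1..<CARD('n). ?a j * p_coord (d_dp (j + 1) - d_dp j :: 'n state) k) = \<dots>" .
  have "p_coord (double_forced \<phi> c x) k =
      (\<Sum>j=1..<CARD('n). ?a j * p_coord (d_dp (j + 1) - d_dp j :: 'n state) k)
      + fst c * p_coord (d_dp 1 :: 'n state) k + snd c * p_coord (d_dp CARD('n) :: 'n state) k"
    unfolding double_forced_bond_form[OF assms(1)] by (simp del: p_coord_linear(2))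
  also have "p_coord (d_dp 1 :: 'n state) k = (if k = 1 then 1 else 0)"
    using coord_basis(2)[where 'n = 'n and j = 1 and k = k] assms by auto
  also have "p_coord (d_dp CARD('n) :: 'n state) k = (if k = CARD('n) then 1 else 0)"
    using coord_basis(2)[where 'n = 'n and j = "CARD('n)" and k = k] assms by auto
  finally have main: "p_coord (double_forced \<phi> c x) k =
      (if k > 1 then ?a (k - 1) else 0) - (if k < CARD('n) then ?a k else 0)
      + fst c * (if k = 1 then 1 else 0) + snd c * (if k = CARD('n) then 1 else 0)"
    unfolding bonds .
  have pred: "k - 1 + 1 = k" using k by simp
  consider "k = 1" "k < CARD('n)" | "k > 1" "k < CARD('n)" | "k > 1" "k = CARD('n)"
    using k assms(1) by fastforce
  then show ?thesis
    unfolding main pred by cases simp_all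
qed

section \<open>Lipschitz estimates and countable level sets\<close>

lemma lipschitz_on_sum:
  fixes f :: "'i \<Rightarrow> 'a::metric_space \<Rightarrow> 'b::real_normed_vector"
  assumes "\<And>i. i \<in> I \<Longrightarrow> \<exists>K. K-lipschitz_on X (f i)"
  shows "\<exists>K. K-lipschitz_on X (\<lambda>x. \<Sum>i\<in>I. f i x)"
  using assms
proof (induction I rule: infinite_finite_induct)
  case (insert i I)
  then obtain K K' where "K-lipschitz_on X (f i)" "K'-lipschitz_on X (\<lambda>x. \<Sum>i\<in>I. f i x)"
    by blast
  from lipschitz_on_add[OF this] show ?case
    using insert.hyps by auto
qed (auto intro: lipschitz_on_constant)

lemma lipschitz_on_scaleR_vector:
  fixes f :: "'a::metric_space \<Rightarrow> real" and v :: "'b::real_normed_vector"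
  assumes "K-lipschitz_on X f"
  shows "(norm v * K)-lipschitz_on X (\<lambda>x. f x *\<^sub>R v)"
proof (rule lipschitz_onI)
  fix x y assume "x \<in> X" "y \<in> X"
  then have "dist (f x) (f y) \<le> K * dist x y" by (rule lipschitz_onD[OF assms])
  then have "norm v * dist (f x) (f y) \<le> norm v * (K * dist x y)"
    by (rule mult_left_mono) simp
  then show "dist (f x *\<^sub>R v) (f y *\<^sub>R v) \<le> norm v * K * dist x y"
    by (simp add: dist_norm scaleR_diff_left[symmetric] mult.commute mult.left_commute)
qed (use lipschitz_on_nonneg[OF assms] in auto)

lemma bounded_linear_lipschitz_on:
  assumes "bounded_linear f"
  shows "\<exists>K. K-lipschitz_on X f"
  using bounded_linear.lipschitz_boundE[OF assms] by metis

lemma C1_lipschitz_on_interval: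
  fixes g :: "real \<Rightarrow> real"
  assumes "\<And>y. (g has_real_derivative g' y) (at y)" and "continuous_on UNIV g'"
  shows "\<exists>K. K-lipschitz_on {-R..R} g"
proof -
  have "compact (g' ` {-R..R})"
    using assms(2) continuous_on_subset by (intro compact_continuous_image) auto
  then obtain K where K: "K > 0" "\<And>y. y \<in> {-R..R} \<Longrightarrow> norm (g' y) \<le> K"
    using compact_imp_bounded bounded_pos by (metis imageI)
  have "K-lipschitz_on {-R..R} g"
  proof (rule lipschitz_onI)
    fix x y assume "x \<in> {-R..R}" "y \<in> {-R..R}"
    then show "dist (g x) (g y) \<le> K * dist x y"
      unfolding dist_norm
      by (intro field_differentiable_bound[of "{-R..R}" g g' K]
          has_field_derivative_at_within[OF assms(1)] K) auto
  qed (use K in auto)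
  then show ?thesis by blast
qed

text \<open>A connected set of reals with two points is uncountable, so a continuous function cannot
  move inside a countable level.\<close>

lemma constant_on_countable_level:
  fixes g :: "real \<Rightarrow> real"
  assumes "continuous_on {0..h} g" "countable {y. \<phi> y = u}"
    and "\<And>t. t \<in> {0..h} \<Longrightarrow> \<phi> (c - g t) = u" and t: "t \<in> {0..h}"
  shows "g t = g 0"
proof (rule ccontr)
  assume "g t \<noteq> g 0"
  let ?S = "(\<lambda>t. c - g t) ` {0..h}"
  have "connected ?S"
    by (intro connected_continuous_image continuous_intros assms(1)) auto
  moreover have "c - g t \<in> ?S" "c - g 0 \<in> ?S"
    using t by (auto intro!: imageI)
  ultimately have "uncountable ?S"
    using connected_uncountable[of ?S "c - g t" "c - g 0"] \<open>g t \<noteq> g 0\<close> by simp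
  moreover have "?S \<subseteq> {y. \<phi> y = u}"
    using assms(3) by auto
  ultimately show False
    using assms(2) countable_subset by blast
qed

text \<open>Analyticity is passed on as continuity of \<open>\<psi>\<close> and the two countability
  assumptions; \<open>dummy\<close> fixes the index type of the particles.\<close>

locale chain =
  fixes \<Phi> \<phi> \<psi> :: "real \<Rightarrow> real" and dummy :: "'n::{finite,linorder} itself"
  assumes two_le_n: "CARD('n) \<ge> 2"
    and bdd: "bdd_below (range \<Phi>)"
    and at_top: "filterlim \<Phi> at_top at_top"
    and \<Phi>_deriv: "\<And>y. (\<Phi> has_real_derivative \<phi> y) (at y)"
    and \<phi>_deriv: "\<And>y. (\<phi> has_real_derivative \<psi> y) (at y)"
    and cont_\<psi>: "continuous_on UNIV \<psi>"
    and countable_level: "\<And>u. countable {y. \<phi> y = u}"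
    and countable_critical: "countable {y. \<psi> y = 0}"
begin

abbreviation F :: "real \<times> real \<Rightarrow> 'n state \<Rightarrow> 'n state" where
  "F \<equiv> double_forced \<phi>"

lemma lipschitz_field:
  assumes "bounded X"
  shows "\<exists>K. K-lipschitz_on X (control_field F)"
proof -
  have bond: "\<exists>K. K-lipschitz_on X (\<lambda>(x :: 'n state, c :: real \<times> real).
      \<phi> (q_coord x k - q_coord x (k + 1)) *\<^sub>R (v :: 'n state))" for k v
  proof -
    let ?l = "\<lambda>z :: 'n state \<times> (real \<times> real). q_coord (fst z) k - q_coord (fst z) (k + 1)"
    have l: "bounded_linear ?l"
      by (intro bounded_linear_sub bounded_linear_compose[OF bounded_linear_q_coord bounded_linear_fst])
    obtain R where "\<And>z. z \<in> X \<Longrightarrow> norm (?l z) \<le> R"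
      using bounded_linear_image[OF assms l] by (auto simp: bounded_iff)
    then have sub: "?l ` X \<subseteq> {-R..R}" by (force simp: abs_le_iff)
    obtain K1 where K1: "K1-lipschitz_on X ?l" using bounded_linear_lipschitz_on[OF l] by blast
    obtain K2 where K2: "K2-lipschitz_on {-R..R} \<phi>"
      using C1_lipschitz_on_interval[OF \<phi>_deriv cont_\<psi>] by blast
    have "(K2 * K1)-lipschitz_on X (\<phi> \<circ> ?l)"
      by (rule lipschitz_on_compose[OF K1 lipschitz_on_subset[OF K2 sub]])
    from lipschitz_on_scaleR_vector[OF this, of v] show ?thesis
      by (auto simp: case_prod_beta comp_def)
  qed
  have lin: "\<exists>K. K-lipschitz_on X (\<lambda>z. f z *\<^sub>R (v :: 'n state))" if "bounded_linear f" for f v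
    by (rule bounded_linear_lipschitz_on) (rule bounded_linear_compose[OF bounded_linear_scaleR_left that])
  have "\<exists>K. K-lipschitz_on X (\<lambda>(x :: 'n state, c). F c x)"
  proof -
    obtain K1 where 1: "K1-lipschitz_on X (\<lambda>z. \<Sum>k=1..CARD('n). p_coord (fst z) k *\<^sub>R (d_dq k :: 'n state))"
      using lipschitz_on_sum[of "{1..CARD('n)}" X "\<lambda>k z. p_coord (fst z) k *\<^sub>R (d_dq k :: 'n state)"]
        lin[OF bounded_linear_compose[OF bounded_linear_p_coord bounded_linear_fst]] by blast
    obtain K2 where 2: "K2-lipschitz_on X (\<lambda>z. \<Sum>k=1..<CARD('n).
        \<phi> (q_coord (fst z) k - q_coord (fst z) (k + 1)) *\<^sub>R (d_dp (k + 1) - d_dp k :: 'n state))"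
      using lipschitz_on_sum[of "{1..<CARD('n)}" X "\<lambda>k z. \<phi> (q_coord (fst z) k - q_coord (fst z) (k + 1))
          *\<^sub>R (d_dp (k + 1) - d_dp k :: 'n state)"] bond unfolding case_prod_beta by blast
    obtain K3 where 3: "K3-lipschitz_on X (\<lambda>z. fst (snd z) *\<^sub>R (d_dp 1 :: 'n state))"
      using lin[OF bounded_linear_compose[OF bounded_linear_fst bounded_linear_snd]] by blast
    obtain K4 where 4: "K4-lipschitz_on X (\<lambda>z. snd (snd z) *\<^sub>R (d_dp CARD('n) :: 'n state))"
      using lin[OF bounded_linear_compose[OF bounded_linear_snd bounded_linear_snd]] by blast
    show ?thesis
      unfolding double_forced_bond_form[OF two_le_n] case_prod_beta
      using lipschitz_on_add[OF lipschitz_on_add[OF lipschitz_on_add[OF 1 2] 3] 4] by blast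
  qed
  then obtain K where "K-lipschitz_on X (\<lambda>(x :: 'n state, c). F c x)" by blast
  from lipschitz_on_Pair[OF this lipschitz_on_constant[of X 0]] show ?thesis
    by (auto simp: control_field_def case_prod_beta)
qed

lemma approx_reach_impulses:
  "approx_reach F x (x + r *\<^sub>R d_dp 1 + s *\<^sub>R d_dp CARD('n))"
proof -
  have "\<exists>K. K-lipschitz_on (cball y \<rho>) (F (0, 0))" for y \<rho>
  proof -
    obtain K where K: "K-lipschitz_on (cball y \<rho> \<times> {(0, 0)}) (control_field F)"
      using lipschitz_field[of "cball y \<rho> \<times> {(0, 0)}"] by (auto simp: bounded_Times)
    have "K-lipschitz_on (cball y \<rho>) (F (0, 0))"
    proof (rule lipschitz_onI)
      fix a b assume "a \<in> cball y \<rho>" "b \<in> cball y \<rho>"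
      then show "dist (F (0, 0) a) (F (0, 0) b) \<le> K * dist a b"
        using lipschitz_onD[OF K, of "(a, 0, 0)" "(b, 0, 0)"]
        by (simp add: control_field_def dist_Pair_Pair)
    qed (rule lipschitz_on_nonneg[OF K])
    then show ?thesis by blast
  qed
  then have "approx_reach F x (x + r *\<^sub>R d_dp 1)"
    "approx_reach F (x + r *\<^sub>R d_dp 1) (x + r *\<^sub>R d_dp 1 + s *\<^sub>R d_dp CARD('n))"
    using approx_reach_impulse[where F = F and f = "F (0, 0)" and cc = "\<lambda>r. (r, 0)"]
      approx_reach_impulse[where F = F and f = "F (0, 0)" and cc = "\<lambda>r. (0, r)"]
    by (simp_all add: double_forced_def)
  then show ?thesis by (rule approx_reach_trans)
qed

section \<open>The energy augmented by two springs\<close>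

definition energy :: "real \<Rightarrow> real \<Rightarrow> 'n state \<Rightarrow> real" where
  "energy \<alpha> \<beta> x = (snd x \<bullet> snd x) / 2 + (\<Sum>k=1..<CARD('n). \<Phi> (q_coord x k - q_coord x (k + 1)))
     + (q_coord x 1 - \<alpha>)\<^sup>2 / 2 + (q_coord x CARD('n) - \<beta>)\<^sup>2 / 2"

lemma has_derivative_q_coord:
  fixes \<gamma> :: "real \<Rightarrow> 'n state"
  assumes "(\<gamma> has_vector_derivative F c (\<gamma> t)) (at t within S)" and "k \<in> {1..CARD('n)}"
  shows "((\<lambda>t. q_coord (\<gamma> t) k) has_real_derivative p_coord (\<gamma> t) k) (at t within S)"
  using bounded_linear.has_vector_derivative[OF bounded_linear_q_coord assms(1), of k]
  by (simp add: q_coord_double_forced[OF two_le_n assms(2)] has_real_derivative_iff_has_vector_derivative)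

lemma snd_double_forced_inner:
  fixes x :: "'n state"
  shows "snd x \<bullet> snd (F c x) =
    (\<Sum>k=1..<CARD('n). \<phi> (q_coord x k - q_coord x (k + 1)) * (p_coord x (k + 1) - p_coord x k))
    + fst c * p_coord x 1 + snd c * p_coord x CARD('n)"
proof -
  have 1: "snd x \<bullet> snd (d_dp k) = p_coord x k" for k
    by (simp add: d_dp_def p_coord_def inner_axis)
  have 2: "snd (d_dq k :: 'n state) = 0" for k
    by (simp add: d_dq_def)
  show ?thesis
    unfolding double_forced_bond_form[OF two_le_n]
    by (simp add: snd_sum inner_add_right inner_sum_right inner_diff_right 1 2)
qed

text \<open>Kinetic and bond energy only exchange with each other, so what remains is the power of
  the controls and of the springs at the two ends. Each bracket is the failure of the control to
  balance its spring.\<close>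

lemma has_derivative_energy:
  fixes \<gamma> :: "real \<Rightarrow> 'n state"
  assumes \<gamma>: "(\<gamma> has_vector_derivative F c (\<gamma> t)) (at t within S)"
  shows "((\<lambda>t. energy \<alpha> \<beta> (\<gamma> t)) has_real_derivative
     p_coord (\<gamma> t) 1 * (fst c + q_coord (\<gamma> t) 1 - \<alpha>)
     + p_coord (\<gamma> t) CARD('n) * (snd c + q_coord (\<gamma> t) CARD('n) - \<beta>)) (at t within S)"
proof -
  let ?q = "\<lambda>k t. q_coord (\<gamma> t) k" and ?p = "\<lambda>k. p_coord (\<gamma> t) k"
  have q: "((\<lambda>t. ?q k t) has_real_derivative ?p k) (at t within S)" if "k \<in> {1..CARD('n)}" for k
    by (rule has_derivative_q_coord[OF \<gamma> that])
  have kin: "((\<lambda>t. (snd (\<gamma> t) \<bullet> snd (\<gamma> t)) / 2) has_real_derivative snd (\<gamma> t) \<bullet> snd (F c (\<gamma> t))) (at t within S)"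
  proof -
    have "((\<lambda>t. snd (\<gamma> t)) has_derivative (\<lambda>u. u *\<^sub>R snd (F c (\<gamma> t)))) (at t within S)"
      using has_vector_derivative_snd[OF \<gamma>] by (simp add: has_vector_derivative_def)
    from has_derivative_inner[OF this this]
    have "((\<lambda>t. snd (\<gamma> t) \<bullet> snd (\<gamma> t)) has_real_derivative 2 * (snd (\<gamma> t) \<bullet> snd (F c (\<gamma> t)))) (at t within S)"
      unfolding has_field_derivative_def
      by (rule has_derivative_eq_rhs) (simp add: fun_eq_iff inner_commute)
    from DERIV_cdivide[OF this, of 2] show ?thesis by simp
  qed
  have pot: "((\<lambda>t. \<Sum>k=1..<CARD('n). \<Phi> (?q k t - ?q (k + 1) t)) has_real_derivative
      (\<Sum>k=1..<CARD('n). \<phi> (?q k t - ?q (k + 1) t) * (?p k - ?p (k + 1)))) (at t within S)"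
  proof (rule DERIV_sum)
    fix k assume "k \<in> {1..<CARD('n)}"
    then show "((\<lambda>t. \<Phi> (?q k t - ?q (k + 1) t)) has_real_derivative \<phi> (?q k t - ?q (k + 1) t) * (?p k - ?p (k + 1))) (at t within S)"
      by (intro DERIV_chain2[OF \<Phi>_deriv] DERIV_diff q) auto
  qed
  have conf: "((\<lambda>t. (?q k t - a)\<^sup>2 / 2) has_real_derivative ?p k * (?q k t - a)) (at t within S)"
    if "k \<in> {1..CARD('n)}" for k a
    using q[OF that] by (auto intro!: derivative_eq_intros)
  have "(\<Sum>k=1..<CARD('n). \<phi> (?q k t - ?q (k + 1) t) * (?p (k + 1) - ?p k)) =
      - (\<Sum>k=1..<CARD('n). \<phi> (?q k t - ?q (k + 1) t) * (?p k - ?p (k + 1)))"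
    by (simp add: sum_negf[symmetric] algebra_simps)
  then have eq: "snd (\<gamma> t) \<bullet> snd (F c (\<gamma> t)) + (\<Sum>k=1..<CARD('n). \<phi> (?q k t - ?q (k + 1) t) * (?p k - ?p (k + 1)))
      + ?p 1 * (?q 1 t - \<alpha>) + ?p CARD('n) * (?q CARD('n) t - \<beta>) =
    ?p 1 * (fst c + ?q 1 t - \<alpha>) + ?p CARD('n) * (snd c + ?q CARD('n) t - \<beta>)"
    unfolding snd_double_forced_inner by (simp add: algebra_simps)
  show ?thesis
    unfolding energy_def eq[symmetric]
    by (rule DERIV_add[OF DERIV_add[OF DERIV_add[OF kin pot] conf] conf]) (use two_le_n in auto)
qed

text \<open>With \<open>r\<close> and \<open>s\<close> the negatives of the end momenta, the energy
  drops by the kinetic energy of the end particles. The cross term vanishes because the two ends are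
  different particles.\<close>

lemma energy_impulses:
  fixes x :: "'n state"
  shows "energy \<alpha> \<beta> (x + r *\<^sub>R d_dp 1 + s *\<^sub>R d_dp CARD('n)) =
    energy \<alpha> \<beta> x + r * p_coord x 1 + s * p_coord x CARD('n) + r\<^sup>2 / 2 + s\<^sup>2 / 2"
proof -
  let ?n = "CARD('n)"
  have inner: "snd y \<bullet> snd (d_dp k) = p_coord y k" for k and y :: "'n state"
    by (simp add: d_dp_def p_coord_def inner_axis)
  have n: "1 \<in> {1..?n}" "?n \<in> {1..?n}" "?n \<noteq> 1" using two_le_n by auto
  have expand: "(v + r *\<^sub>R g + s *\<^sub>R h) \<bullet> (v + r *\<^sub>R g + s *\<^sub>R h) =
      v \<bullet> v + 2 * r * (v \<bullet> g) + 2 * s * (v \<bullet> h) + r\<^sup>2 * (g \<bullet> g) + s\<^sup>2 * (h \<bullet> h) + 2 * r * s * (g \<bullet> h)"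
    for v g h :: "'v::real_inner"
    by (simp add: inner_add_left inner_add_right inner_commute power2_eq_square algebra_simps)
  have basis: "snd (d_dp 1 :: 'n state) \<bullet> snd (d_dp 1 :: 'n state) = 1"
    "snd (d_dp ?n :: 'n state) \<bullet> snd (d_dp ?n :: 'n state) = 1"
    "snd (d_dp 1 :: 'n state) \<bullet> snd (d_dp ?n :: 'n state) = 0"
    unfolding inner using coord_basis(2)[OF n(1) n(1)] coord_basis(2)[OF n(2) n(2)]
      coord_basis(2)[OF n(1) n(2)] n(3) by simp_all
  let ?y = "x + r *\<^sub>R d_dp 1 + s *\<^sub>R d_dp ?n"
  have y: "snd ?y = snd x + r *\<^sub>R snd (d_dp 1) + s *\<^sub>R snd (d_dp ?n)"
    by simp
  have kin: "snd ?y \<bullet> snd ?y =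
    snd x \<bullet> snd x + 2 * r * p_coord x 1 + 2 * s * p_coord x ?n + r\<^sup>2 + s\<^sup>2"
    unfolding y expand unfolding basis unfolding inner by simp
  have q: "q_coord ?y k = q_coord x k" for k by simp
  show ?thesis
    unfolding energy_def kin q by (simp add: add_divide_distrib)
qed

lemma continuous_energy: "continuous_on UNIV (energy \<alpha> \<beta>)"
proof -
  have q: "continuous_on UNIV (\<lambda>x :: 'n state. q_coord x k)" for k
    using linear_continuous_on[OF bounded_linear_q_coord] .
  have "continuous_on UNIV \<Phi>"
    by (intro continuous_at_imp_continuous_on ballI DERIV_isCont[OF \<Phi>_deriv])
  then have "continuous_on UNIV (\<lambda>x :: 'n state. \<Phi> (q_coord x k - q_coord x (k + 1)))" for k
    by (rule continuous_on_compose2) (auto intro!: continuous_intros q)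
  then show ?thesis
    unfolding energy_def by (intro continuous_intros q) auto
qed

text \<open>Bounded bond energy limits \<open>q_coord x k - q_coord x (k + 1)\<close> from above
  only. So each particle is bounded below through the first one and above through the last one,
  which is why both ends are tied.\<close>

lemma bounded_energy_sublevel: "bounded {x. energy \<alpha> \<beta> x \<le> M}"
proof -
  let ?n = "CARD('n)"
  obtain b where b: "\<And>y. b \<le> \<Phi> y"
    using bdd by (auto simp: bdd_below_def)
  \<comment> \<open>What remains of \<open>M\<close> once every bond energy is shifted by its lower
    bound \<open>b\<close>, making all terms nonnegative.\<close>
  define M' where "M' = M - of_nat (card {1..<?n}) * b"
  obtain R where R: "R \<ge> 0" "\<And>y. \<Phi> y \<le> M' + b \<Longrightarrow> y \<le> R"
  proof -
    obtain R where "\<And>y. y \<ge> R \<Longrightarrow> \<Phi> y > M' + b"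
      using at_top by (auto simp: filterlim_at_top_dense eventually_at_top_linorder)
    then show ?thesis
      by (intro that[of "max R 0"]) (auto simp: not_le[symmetric] intro: ccontr)
  qed
  define B where "B = \<bar>\<alpha>\<bar> + \<bar>\<beta>\<bar> + sqrt (2 * M') + real ?n * R"
  have "norm x \<le> sqrt (2 * M') + real ?n * B" if x: "energy \<alpha> \<beta> x \<le> M" for x :: "'n state"
  proof -
    let ?q = "q_coord x" and ?S = "\<Sum>k=1..<?n. \<Phi> (q_coord x k - q_coord x (k + 1)) - b"
    have S: "?S = (\<Sum>k=1..<?n. \<Phi> (?q k - ?q (k + 1))) - of_nat (card {1..<?n}) * b"
      by (simp add: sum_subtractf)
    have nonneg: "0 \<le> \<Phi> y - b" for y using b[of y] by simp
    have le: "(snd x \<bullet> snd x) / 2 + ?S + (?q 1 - \<alpha>)\<^sup>2 / 2 + (?q ?n - \<beta>)\<^sup>2 / 2 \<le> M'"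
      using x unfolding S energy_def M'_def by linarith
    have S0: "0 \<le> ?S" by (rule sum_nonneg) (rule nonneg)
    have sqs: "0 \<le> snd x \<bullet> snd x" "0 \<le> (?q 1 - \<alpha>)\<^sup>2" "0 \<le> (?q ?n - \<beta>)\<^sup>2" by auto
    have r: "?q k - ?q (k + 1) \<le> R" if "k \<in> {1..<?n}" for k
    proof (rule R(2))
      have "\<Phi> (?q k - ?q (k + 1)) - b \<le> ?S"
        by (rule member_le_sum[OF that]) (use nonneg in auto)
      then show "\<Phi> (?q k - ?q (k + 1)) \<le> M' + b" using le sqs by linarith
    qed
    have diff: "?q i - ?q j \<le> real ?n * R" if "1 \<le> i" "i \<le> j" "j \<le> ?n" for i j
    proof -
      have "?q i - ?q j \<le> real (j - i) * R"
        using \<open>i \<le> j\<close> \<open>j \<le> ?n\<close>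
      proof (induction j rule: dec_induct)
        case (step j)
        then have "?q j - ?q (j + 1) \<le> R" using \<open>1 \<le> i\<close> by (intro r) auto
        moreover have "real (Suc j - i) * R = real (j - i) * R + R"
          using step by (simp add: Suc_diff_le algebra_simps)
        ultimately show ?case using step by simp
      qed simp
      also have "\<dots> \<le> real ?n * R"
        using that R(1) by (intro mult_right_mono) auto
      finally show ?thesis .
    qed
    have "\<bar>?q 1 - \<alpha>\<bar>\<^sup>2 \<le> 2 * M'" "\<bar>?q ?n - \<beta>\<bar>\<^sup>2 \<le> 2 * M'"
      unfolding power2_abs using le sqs S0 by linarith+
    then have q1: "\<bar>?q 1 - \<alpha>\<bar> \<le> sqrt (2 * M')" and qn: "\<bar>?q ?n - \<beta>\<bar> \<le> sqrt (2 * M')"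
      by (auto intro: real_le_rsqrt)
    have pB: "norm (snd x) \<le> sqrt (2 * M')"
      unfolding norm_eq_sqrt_inner by (rule real_sqrt_le_mono) (use le sqs S0 in linarith)
    have qB: "\<bar>?q k\<bar> \<le> B" if "k \<in> {1..?n}" for k
      using diff[of 1 k] diff[of k ?n] that q1 qn unfolding B_def by auto
    have "norm (fst x) \<le> (\<Sum>i\<in>UNIV. \<bar>fst x $ i\<bar>)"
      by (rule norm_le_l1_cart)
    also have "\<dots> = (\<Sum>k=1..?n. \<bar>?q k\<bar>)"
      by (simp add: sum_particle q_coord_def)
    also have "\<dots> \<le> of_nat (card {1..?n}) * B"
      by (rule sum_bounded_above) (rule qB)
    finally have "norm (fst x) \<le> real ?n * B" by simp
    then show ?thesis
      using pB norm_Pair_le[of "fst x" "snd x"] by simp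
  qed
  then show ?thesis
    by (auto simp: bounded_iff)
qed

section \<open>Equilibria under tension\<close>

definition tension_equilibrium :: "real \<Rightarrow> 'n state \<Rightarrow> bool" where
  "tension_equilibrium u x \<longleftrightarrow> snd x = 0 \<and> (\<forall>k\<in>{1..<CARD('n)}. \<phi> (q_coord x k - q_coord x (k + 1)) = u)"

lemma tension_equilibrium_field:
  assumes "tension_equilibrium u x"
  shows "F (u, - u) x = 0"
proof -
  have "p_coord x k = 0" for k
    using assms by (simp add: tension_equilibrium_def p_coord_def)
  moreover have "(\<Sum>k=1..<CARD('n). \<phi> (q_coord x k - q_coord x (k + 1)) *\<^sub>R (d_dp (k + 1) - d_dp k :: 'n state)) =
      (\<Sum>k=1..<CARD('n). u *\<^sub>R d_dp (Suc k) - u *\<^sub>R d_dp k)"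
    by (rule sum.cong) (use assms in \<open>auto simp: tension_equilibrium_def scaleR_diff_right\<close>)
  moreover have "\<dots> = u *\<^sub>R d_dp CARD('n) - u *\<^sub>R d_dp 1"
    using two_le_n by (intro sum_Suc_diff') auto
  ultimately show ?thesis
    unfolding double_forced_bond_form[OF two_le_n] by simp
qed

text \<open>A minimiser of the energy over the approximately reachable states has resting end particles, since
  impulses can stop them. Under the constant controls balancing the two springs the energy then grows
  exactly by the potential energy of the displacements of the end particles, while stopping them recovers
  their kinetic energy; so they never move, and the whole chain is at rest.\<close>

lemma minimiser_is_equilibrium:
  assumes reach_m: "approx_reach F x m"
    and min: "\<And>y. approx_reach F x y \<Longrightarrow> energy \<alpha> \<beta> m \<le> energy \<alpha> \<beta> y"
  shows "tension_equilibrium (\<alpha> - q_coord m 1) m \<and> \<alpha> - q_coord m 1 = q_coord m CARD('n) - \<beta>"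
proof -
  let ?n = "CARD('n)"
  \<comment> \<open>The spring forces at \<open>m\<close>, frozen as a constant control.\<close>
  define u v where "u = \<alpha> - q_coord m 1" and "v = \<beta> - q_coord m ?n"
  have n: "1 \<in> {1..?n}" "?n \<in> {1..?n}" using two_le_n by auto
  obtain h0 \<gamma> where h0: "h0 > 0" and \<gamma>0: "\<gamma> 0 = m"
    and \<gamma>': "\<And>t. t \<in> {0..h0} \<Longrightarrow> (\<gamma> has_vector_derivative F (u, v) (\<gamma> t)) (at t within {0..h0})"
    and reach_\<gamma>': "\<And>t. t \<in> {0..h0} \<Longrightarrow> approx_reach F m (\<gamma> t)"
    by (rule approx_reach_constant_control[where x = m and c = "(u, v)", OF lipschitz_field[OF bounded_cball]])
       (rule that; assumption)
  \<comment> \<open>The 1/2 is for \<open>short_time_bound\<close> with \<open>K = 1\<close>,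
    applied to the displacement \<open>D\<close>.\<close>
  define h where "h = min h0 (1/2)"
  have h: "h > 0" "h * 1 \<le> 1/2" "h \<le> h0" using h0 by (auto simp: h_def)
  have \<gamma>: "(\<gamma> has_vector_derivative F (u, v) (\<gamma> t)) (at t within {0..h})" if "t \<in> {0..h}" for t
    by (rule has_vector_derivative_within_subset[OF \<gamma>']) (use that h in auto)
  have q_der: "((\<lambda>t. q_coord (\<gamma> t) k) has_real_derivative p_coord (\<gamma> t) k) (at t within {0..h})"
    if "t \<in> {0..h}" "k \<in> {1..?n}" for t k
    by (rule has_derivative_q_coord[OF \<gamma>[OF that(1)] that(2)])
  have p_der: "((\<lambda>t. p_coord (\<gamma> t) k) has_vector_derivative p_coord (F (u, v) (\<gamma> t)) k) (at t within {0..h})"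
    if "t \<in> {0..h}" for t k
    by (rule bounded_linear.has_vector_derivative[OF bounded_linear_p_coord \<gamma>[OF that]])
  have stop: "energy \<alpha> \<beta> m \<le> energy \<alpha> \<beta> y - (p_coord y 1)\<^sup>2 / 2 - (p_coord y ?n)\<^sup>2 / 2"
    if "approx_reach F m y" for y
  proof -
    have "approx_reach F x (y + (- p_coord y 1) *\<^sub>R d_dp 1 + (- p_coord y ?n) *\<^sub>R d_dp ?n)"
      by (rule approx_reach_trans[OF reach_m approx_reach_trans[OF that approx_reach_impulses]])
    from min[OF this] show ?thesis
      unfolding energy_impulses by (simp add: power2_eq_square)
  qed
  let ?\<delta>1 = "\<lambda>t. q_coord (\<gamma> t) 1 - q_coord m 1" and ?\<delta>n = "\<lambda>t. q_coord (\<gamma> t) ?n - q_coord m ?n"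
  have energy_\<gamma>: "energy \<alpha> \<beta> (\<gamma> t) = energy \<alpha> \<beta> m + (?\<delta>1 t)\<^sup>2 / 2 + (?\<delta>n t)\<^sup>2 / 2" if t: "t \<in> {0..h}" for t
  proof -
    let ?g = "\<lambda>t. energy \<alpha> \<beta> (\<gamma> t) - (?\<delta>1 t)\<^sup>2 / 2 - (?\<delta>n t)\<^sup>2 / 2"
    have der: "(?g has_real_derivative 0) (at s within {0..h})" if s: "s \<in> {0..h}" for s
    proof -
      have "((\<lambda>t. (q_coord (\<gamma> t) k - c)\<^sup>2 / 2) has_real_derivative p_coord (\<gamma> s) k * (q_coord (\<gamma> s) k - c)) (at s within {0..h})"
        if "k \<in> {1..?n}" for k c
        using q_der[OF s that] by (auto intro!: derivative_eq_intros)
      from DERIV_diff[OF DERIV_diff[OF has_derivative_energy[OF \<gamma>[OF s]] this[OF n(1)]] this[OF n(2)]]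
      show ?thesis
        by (rule DERIV_cong) (simp add: u_def v_def algebra_simps)
    qed
    have "?g t = ?g 0"
      by (rule has_field_derivative_zero_constant[THEN exE, of "{0..h}" ?g])
         (use der t h in auto)
    then show ?thesis by (simp add: \<gamma>0)
  qed
  define D where "D t = (?\<delta>1 t, ?\<delta>n t)" for t
  \<comment> \<open>By \<open>stop\<close> and \<open>energy_\<gamma>\<close> the velocity of
    \<open>D\<close> is at most as long as \<open>D\<close> itself, and \<open>D\<close> starts at
    0.\<close>
  have D: "D t = 0" if t: "t \<in> {0..h}" for t
  proof -
    have "norm (D t) \<le> 2 * (norm (D 0) + h * 0)"
    proof (rule short_time_bound[where K = 1 and f' = "\<lambda>t. (p_coord (\<gamma> t) 1, p_coord (\<gamma> t) ?n)"])
      fix s assume s: "s \<in> {0..h}"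
      show "(D has_vector_derivative (p_coord (\<gamma> s) 1, p_coord (\<gamma> s) ?n)) (at s within {0..h})"
        unfolding D_def
        using q_der[OF s n(1)] q_der[OF s n(2)]
        by (intro has_vector_derivative_Pair)
           (auto simp: has_real_derivative_iff_has_vector_derivative[symmetric] intro!: derivative_eq_intros)
      have "approx_reach F m (\<gamma> s)" using s h by (intro reach_\<gamma>') auto
      from stop[OF this] have "(p_coord (\<gamma> s) 1)\<^sup>2 + (p_coord (\<gamma> s) ?n)\<^sup>2 \<le> (?\<delta>1 s)\<^sup>2 + (?\<delta>n s)\<^sup>2"
        unfolding energy_\<gamma>[OF s] by simp
      then show "norm (p_coord (\<gamma> s) 1, p_coord (\<gamma> s) ?n) \<le> 0 + 1 * norm (D s)"
        by (simp add: D_def norm_Pair)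
    qed (use h t in auto)
    then show ?thesis by (simp add: D_def \<gamma>0 zero_prod_def)
  qed
  have rest: "p_coord (\<gamma> t) k = 0"
    if const: "\<And>t. t \<in> {0..h} \<Longrightarrow> q_coord (\<gamma> t) k = c" and "k \<in> {1..?n}" "t \<in> {0..h}" for k c t
    using zero_function_derivative[of "\<lambda>t. q_coord (\<gamma> t) k" "p_coord (\<gamma> t) k" t h c] q_der[of t k] that h
    by (simp add: has_real_derivative_iff_has_vector_derivative)
  have force: "p_coord (F (u, v) (\<gamma> t)) k = 0"
    if "\<And>t. t \<in> {0..h} \<Longrightarrow> p_coord (\<gamma> t) k = 0" and "t \<in> {0..h}" for t k
    by (rule zero_function_derivative[OF p_der[OF that(2)] that(2) h(1) that(1)])
  \<comment> \<open>Rest propagates from the left: a resting particle feels no net force, so the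
    bond to its right also carries \<open>u\<close>. The length of that bond then lies in a
    countable level of \<open>\<phi>\<close>, which fixes the next particle.\<close>
  have chain: "(\<forall>t\<in>{0..h}. q_coord (\<gamma> t) k = q_coord m k) \<and> (\<forall>t\<in>{0..h}. p_coord (\<gamma> t) k = 0)
      \<and> (k > 1 \<longrightarrow> (\<forall>t\<in>{0..h}. \<phi> (q_coord (\<gamma> t) (k - 1) - q_coord (\<gamma> t) k) = u))" if "1 \<le> k" "k \<le> ?n" for k
    using that
  proof (induction k rule: nat_induct_at_least)
    case base
    have "\<forall>t\<in>{0..h}. q_coord (\<gamma> t) 1 = q_coord m 1"
      using D by (auto simp: D_def zero_prod_def)
    then show ?case using rest[of 1] n by auto
  next
    case (Suc k)
    then have IH: "\<And>t. t \<in> {0..h} \<Longrightarrow> q_coord (\<gamma> t) k = q_coord m k" "\<And>t. t \<in> {0..h} \<Longrightarrow> p_coord (\<gamma> t) k = 0"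
      "\<And>t. k > 1 \<Longrightarrow> t \<in> {0..h} \<Longrightarrow> \<phi> (q_coord (\<gamma> t) (k - 1) - q_coord (\<gamma> t) k) = u" and k: "k \<in> {1..?n}" "k < ?n" "Suc k \<in> {1..?n}"
      by auto
    have level: "\<phi> (q_coord (\<gamma> t) k - q_coord (\<gamma> t) (Suc k)) = u" if t: "t \<in> {0..h}" for t
    proof -
      have "(if k > 1 then \<phi> (q_coord (\<gamma> t) (k - 1) - q_coord (\<gamma> t) k) else fst (u, v)) = u"
        using IH(3)[OF _ t] by simp
      then show ?thesis
        using force[OF IH(2) t] k(2) unfolding p_coord_double_forced[OF two_le_n k(1)] by simp
    qed
    have cont: "continuous_on {0..h} (\<lambda>t. q_coord (\<gamma> t) (Suc k))"
      by (rule DERIV_continuous_on[OF q_der[OF _ k(3)]])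
    have level': "\<phi> (q_coord m k - q_coord (\<gamma> t) (Suc k)) = u" if "t \<in> {0..h}" for t
      using level[OF that] IH(1)[OF that] by simp
    have const: "q_coord (\<gamma> t) (Suc k) = q_coord m (Suc k)" if "t \<in> {0..h}" for t
      using constant_on_countable_level[OF cont countable_level level' that] \<gamma>0 by simp
    show ?case
    proof (intro conjI ballI impI)
      fix t assume t: "t \<in> {0..h}"
      show "q_coord (\<gamma> t) (Suc k) = q_coord m (Suc k)" by (rule const[OF t])
      show "p_coord (\<gamma> t) (Suc k) = 0" by (rule rest[OF const k(3) t])
      show "\<phi> (q_coord (\<gamma> t) (Suc k - 1) - q_coord (\<gamma> t) (Suc k)) = u"
        using level[OF t] by simp
    qed
  qed
  have zero: "0 \<in> {0..h}" using h by simp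
  have tension: "\<phi> (q_coord m k - q_coord m (k + 1)) = u" if "k \<in> {1..<?n}" for k
  proof -
    have "1 \<le> k + 1" "k + 1 \<le> ?n" "k + 1 > 1" using that by auto
    then have "\<forall>t\<in>{0..h}. \<phi> (q_coord (\<gamma> t) (k + 1 - 1) - q_coord (\<gamma> t) (k + 1)) = u"
      using chain[of "k + 1"] by blast
    from bspec[OF this zero] show ?thesis by (simp add: \<gamma>0)
  qed
  have rest_m: "p_coord (\<gamma> t) k = 0" if "k \<in> {1..?n}" "t \<in> {0..h}" for k t
    using chain[of k] that by (meson atLeastAtMost_iff)
  \<comment> \<open>Balance of forces at the last particle relates the second control to the common
    force \<open>u\<close>.\<close>
  have "p_coord (F (u, v) (\<gamma> 0)) ?n = 0"
    by (rule force[OF rest_m[OF n(2)] zero])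
  moreover have "\<phi> (q_coord m (?n - 1) - q_coord m ?n) = u"
    using tension[of "?n - 1"] two_le_n by simp
  ultimately have "u + v = 0"
    unfolding p_coord_double_forced[OF two_le_n n(2)] \<gamma>0 using two_le_n by simp
  moreover have "snd m = 0"
  proof -
    have "m = (fst m, 0)"
    proof (rule state_eqI)
      fix k assume "k \<in> {1..?n}"
      from rest_m[OF this zero] show "p_coord m k = p_coord (fst m, 0) k"
        by (simp add: \<gamma>0 p_coord_def)
    qed (simp add: q_coord_def)
    then show ?thesis by (metis snd_conv)
  qed
  ultimately show ?thesis
    using tension unfolding tension_equilibrium_def u_def v_def by auto
qed

lemma reach_tension_equilibrium:
  obtains u m where "approx_reach F x m" "tension_equilibrium u m"
    "\<alpha> - q_coord m 1 = u" "q_coord m CARD('n) - \<beta> = u"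
proof -
  \<comment> \<open>The sublevel set of \<open>x\<close> makes the set compact and keeps
    \<open>x\<close> in it; states outside have more energy, so the minimum is one over all
    approximately reachable states.\<close>
  let ?C = "{y. approx_reach F x y} \<inter> {y. energy \<alpha> \<beta> y \<le> energy \<alpha> \<beta> x}"
  have "closed {y. energy \<alpha> \<beta> y \<le> energy \<alpha> \<beta> x}"
    by (rule closed_Collect_le[OF continuous_energy continuous_on_const])
  then have "closed ?C"
    by (rule closed_Int[OF closed_approx_reach])
  moreover have "bounded ?C"
    by (rule bounded_subset[OF bounded_energy_sublevel]) blast
  ultimately have "compact ?C"
    by (simp only: compact_eq_bounded_closed)
  moreover have "x \<in> ?C" using approx_reach_refl by auto
  ultimately obtain m where m: "m \<in> ?C" "\<And>y. y \<in> ?C \<Longrightarrow> energy \<alpha> \<beta> m \<le> energy \<alpha> \<beta> y"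
    using continuous_attains_inf[of ?C "energy \<alpha> \<beta>"] continuous_on_subset[OF continuous_energy] by blast
  have reach_m: "approx_reach F x m" using m(1) by simp
  have "energy \<alpha> \<beta> m \<le> energy \<alpha> \<beta> y" if "approx_reach F x y" for y
    using m that by (cases "energy \<alpha> \<beta> y \<le> energy \<alpha> \<beta> x") auto
  from minimiser_is_equilibrium[OF reach_m this] show ?thesis
    using that[OF reach_m] by auto
qed

text \<open>With the second spring fixed at 0, \<open>\<alpha>\<close> equals the sum of the bond
  differences plus \<open>2 * u\<close>. If one bond is critical, \<open>u\<close> is the value of
  \<open>\<phi>\<close> at a zero of \<open>\<psi>\<close>. The other bonds may differ in length, as
  \<open>\<phi>\<close> need not be injective, but all of them lie in the countable set
  \<open>W\<close>, which leaves countably many \<open>\<alpha>\<close>.\<close>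

lemma exists_regular_parameter:
  obtains \<alpha> where "\<And>u m k. tension_equilibrium u m \<Longrightarrow> \<alpha> - q_coord m 1 = u \<Longrightarrow> q_coord m CARD('n) = u \<Longrightarrow>
    k \<in> {1..<CARD('n)} \<Longrightarrow> \<psi> (q_coord m k - q_coord m (k + 1)) \<noteq> 0"
proof -
  define W where "W = (\<Union>z\<in>{z. \<psi> z = 0}. {y. \<phi> y = \<phi> z})"
  have "countable W"
    unfolding W_def using countable_critical countable_level by auto
  \<comment> \<open>All bonds carry the same force, so it can be read off at the first one.\<close>
  then have "countable ((\<lambda>l. sum_list l + 2 * \<phi> (hd l)) ` lists W)"
    by (intro countable_image countable_lists)
  then obtain \<alpha> where \<alpha>: "\<alpha> \<notin> (\<lambda>l. sum_list l + 2 * \<phi> (hd l)) ` lists W"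
    using uncountable_UNIV_real by (metis UNIV_I countable_subset subsetI)
  show ?thesis
  proof (rule that, rule notI)
    fix u m k
    assume m: "tension_equilibrium u m" "\<alpha> - q_coord m 1 = u" "q_coord m CARD('n) = u"
      and k: "k \<in> {1..<CARD('n)}" and crit: "\<psi> (q_coord m k - q_coord m (k + 1)) = 0"
    let ?r = "\<lambda>k. q_coord m k - q_coord m (k + 1)"
    let ?l = "map ?r [1..<CARD('n)]"
    have tension: "\<phi> (?r j) = u" if "j \<in> {1..<CARD('n)}" for j
      using m(1) that by (simp add: tension_equilibrium_def)
    then have "?r j \<in> W" if "j \<in> {1..<CARD('n)}" for j
      unfolding W_def using crit k that by (intro UN_I[of "?r k"]) auto
    then have "?l \<in> lists W" by auto
    moreover have "sum_list ?l = q_coord m 1 - q_coord m CARD('n)"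
    proof -
      have "sum_list ?l = (\<Sum>j=1..<CARD('n). ?r j)"
        by (simp add: interv_sum_list_conv_sum_set_nat)
      also have "\<dots> = - (\<Sum>j=1..<CARD('n). q_coord m (Suc j) - q_coord m j)"
        by (simp add: sum_negf[symmetric])
      also have "\<dots> = - (q_coord m CARD('n) - q_coord m 1)"
        using two_le_n by (subst sum_Suc_diff') auto
      finally show ?thesis by simp
    qed
    moreover have "\<phi> (hd ?l) = u"
      using tension[of 1] two_le_n by (simp add: hd_map)
    ultimately have "\<alpha> = sum_list ?l + 2 * \<phi> (hd ?l)"
      using m(2,3) by simp
    then show False
      using \<alpha> \<open>?l \<in> lists W\<close> by blast
  qed
qed

text \<open>The linearised chain passes a push along: \<open>A\<close> takes \<open>d_dp j\<close>
  to \<open>d_dq j\<close>, and the next application brings in \<open>d_dp (j + 1)\<close> with the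
  bond stiffness \<open>\<kappa> j\<close>. Nonzero stiffnesses carry the force on the first
  particle to every other one, which is the Kalman condition.\<close>

lemma regular_equilibrium_local_reach:
  assumes eq: "tension_equilibrium u m"
    and regular: "\<And>k. k \<in> {1..<CARD('n)} \<Longrightarrow> \<psi> (q_coord m k - q_coord m (k + 1)) \<noteq> 0"
  shows "\<exists>r>0. \<forall>y\<in>ball m r. reach F m y"
proof -
  let ?n = "CARD('n)"
  define \<kappa> where "\<kappa> k = \<psi> (q_coord m k - q_coord m (k + 1))" for k
  define A :: "'n state \<Rightarrow> 'n state" where "A z = (\<Sum>k=1..?n. p_coord z k *\<^sub>R d_dq k)
    + (\<Sum>k=1..<?n. (\<kappa> k * (q_coord z k - q_coord z (k + 1))) *\<^sub>R (d_dp (k + 1) - d_dp k))" for z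
  define B :: "real \<times> real \<Rightarrow> 'n state" where "B \<beta> = fst \<beta> *\<^sub>R d_dp 1 + snd \<beta> *\<^sub>R d_dp ?n" for \<beta>
  have A: "bounded_linear A"
    unfolding A_def
    by (intro bounded_linear_add bounded_linear_sum bounded_linear_compose[OF bounded_linear_scaleR_left]
        bounded_linear_compose[OF bounded_linear_mult_right] bounded_linear_sub
        bounded_linear_q_coord bounded_linear_p_coord)
  interpret A: bounded_linear A by fact
  have B: "bounded_linear B"
    unfolding B_def
    by (intro bounded_linear_add bounded_linear_compose[OF bounded_linear_scaleR_left]
        bounded_linear_fst bounded_linear_snd)
  obtain K where lip: "K-lipschitz_on (cball (m, (u, - u)) 1) (control_field F)"
    using lipschitz_field[OF bounded_cball] by blast
  have der: "(control_field F has_derivative (\<lambda>(z, \<beta>). (A z + B \<beta>, 0))) (at (m, (u, - u)))"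
  proof -
    have bl: "((\<lambda>z. f (fst z)) has_derivative (\<lambda>z. f (fst z))) G"
      if "bounded_linear f" for f :: "'n state \<Rightarrow> real" and G :: "('n state \<times> real \<times> real) filter"
      by (rule bounded_linear_imp_has_derivative[OF bounded_linear_compose[OF that bounded_linear_fst]])
    have bond: "((\<lambda>z. \<phi> (q_coord (fst z) k - q_coord (fst z) (k + 1))) has_derivative
        (\<lambda>z. \<kappa> k * (q_coord (fst z) k - q_coord (fst z) (k + 1)))) (at (m, (u, - u)))" for k
    proof -
      have "(\<phi> has_derivative (*) (\<kappa> k)) (at (q_coord (fst (m, (u, - u))) k - q_coord (fst (m, (u, - u))) (k + 1)))"
        using \<phi>_deriv unfolding \<kappa>_def has_field_derivative_def by simp
      from has_derivative_compose[OF has_derivative_diff[OF bl[OF bounded_linear_q_coord] bl[OF bounded_linear_q_coord]] this]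
      show ?thesis .
    qed
    have "((\<lambda>z. F (snd z) (fst z)) has_derivative (\<lambda>z. A (fst z) + B (snd z))) (at (m, (u, - u)))"
      unfolding double_forced_bond_form[OF two_le_n] A_def B_def add.assoc
      by (intro has_derivative_add has_derivative_sum has_derivative_scaleR_left
          bl[OF bounded_linear_p_coord] bond has_derivative_fst has_derivative_snd has_derivative_ident)
    from has_derivative_Pair[OF this has_derivative_const[of 0]]
    show ?thesis by (simp add: control_field_def case_prod_beta')
  qed
  have kalman: "\<xi> = 0" if \<xi>: "\<And>k \<beta>. \<xi> \<bullet> (A ^^ k) (B \<beta>) = 0" for \<xi>
  proof -
    \<comment> \<open>An \<open>A\<close>-invariant subspace orthogonal to \<open>\<xi>\<close>; it
      will turn out to contain every coordinate vector.\<close>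
    define N where "N = {w. \<forall>k. \<xi> \<bullet> (A ^^ k) w = 0}"
    have lin_k: "linear (A ^^ k)" for k
      by (induction k) (auto intro: linear_compose A.linear_axioms linear_id[unfolded id_def] simp: linear_iff A.add A.scaleR)
    have N: "subspace N"
      unfolding subspace_def N_def
      using linear_0[OF lin_k] linear_add[OF lin_k] linear_scale[OF lin_k]
      by (auto simp: inner_add_right)
    have N_A: "A w \<in> N" if "w \<in> N" for w
    proof -
      have "\<xi> \<bullet> (A ^^ Suc k) w = 0" for k
        using that unfolding N_def by blast
      then show ?thesis
        unfolding N_def by (simp add: funpow_swap1)
    qed
    have dp1: "d_dp 1 \<in> N"
      using \<xi>[of _ "(1, 0)"] by (auto simp: N_def B_def)
    have A_dp: "A (d_dp j) = d_dq j" if "j \<in> {1..?n}" for j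
    proof -
      have "A (d_dp j) = (\<Sum>k=1..?n. p_coord (d_dp j :: 'n state) k *\<^sub>R d_dq k)"
        by (simp add: A_def)
      also have "\<dots> = (\<Sum>k=1..?n. if k = j then d_dq k else 0)"
        by (rule sum.cong) (use that in \<open>auto simp: coord_basis\<close>)
      finally show ?thesis using that by simp
    qed
    have A_dq: "A (d_dq j) = (if j < ?n then \<kappa> j *\<^sub>R (d_dp (j + 1) - d_dp j) else 0)
        - (if j > 1 then \<kappa> (j - 1) *\<^sub>R (d_dp j - d_dp (j - 1)) else 0)" if "j \<in> {1..?n}" for j
    proof -
      have "A (d_dq j) = (\<Sum>k=1..<?n. (\<kappa> k * (q_coord (d_dq j :: 'n state) k - q_coord (d_dq j :: 'n state) (k + 1))) *\<^sub>R (d_dp (k + 1) - d_dp k))"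
        by (simp add: A_def)
      also have "\<dots> = (\<Sum>k=1..<?n. (if k = j then \<kappa> k *\<^sub>R (d_dp (k + 1) - d_dp k) else 0)
          - (if k = j - 1 then \<kappa> k *\<^sub>R (d_dp (k + 1) - d_dp k) else 0))"
        by (rule sum.cong) (use that in \<open>auto simp: coord_basis\<close>)
      also have "\<dots> = (if j < ?n then \<kappa> j *\<^sub>R (d_dp (j + 1) - d_dp j) else 0)
          - (if j > 1 then \<kappa> (j - 1) *\<^sub>R (d_dp (j - 1 + 1) - d_dp (j - 1)) else 0)"
        unfolding sum_subtractf sum.delta[OF finite_atLeastLessThan] using that by auto
      finally show ?thesis using that by simp
    qed
    have dp: "\<forall>i\<in>{1..j}. d_dp i \<in> N" if "1 \<le> j" "j \<le> ?n" for j
      using that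
    proof (induction j rule: nat_induct_at_least)
      case base
      then show ?case using dp1 by simp
    next
      case (Suc j)
      then have j: "j \<in> {1..?n}" "j < ?n" and IH: "\<And>i. i \<in> {1..j} \<Longrightarrow> d_dp i \<in> N" by auto
      have "A (d_dq j) \<in> N"
        using N_A[OF N_A[OF IH[of j]]] A_dp[OF j(1)] j by simp
      moreover have "(if j > 1 then \<kappa> (j - 1) *\<^sub>R (d_dp j - d_dp (j - 1)) else 0) \<in> N"
        using IH[of j] IH[of "j - 1"] j N by (auto intro!: subspace_scale subspace_diff subspace_0)
      ultimately have "\<kappa> j *\<^sub>R (d_dp (j + 1) - d_dp j) \<in> N"
        using subspace_add[OF N] unfolding A_dq[OF j(1)] using j(2) by fastforce
      moreover have "\<kappa> j \<noteq> 0" using regular[of j] j by (simp add: \<kappa>_def)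
      ultimately have "d_dp (j + 1) - d_dp j \<in> N"
        using subspace_scale[OF N, of "\<kappa> j *\<^sub>R (d_dp (j + 1) - d_dp j)" "1 / \<kappa> j"] by simp
      from subspace_add[OF N this IH[of j]] have "d_dp (Suc j) \<in> N" using j by simp
      then show ?case using IH by (auto simp: le_Suc_eq)
    qed
    have "\<xi> \<bullet> d_dp k = 0" "\<xi> \<bullet> d_dq k = 0" if k: "k \<in> {1..?n}" for k
    proof -
      have "d_dp k \<in> N" using dp[of ?n] k by auto
      moreover from N_A[OF this] have "d_dq k \<in> N" using A_dp[OF k] by simp
      ultimately show "\<xi> \<bullet> d_dp k = 0" "\<xi> \<bullet> d_dq k = 0"
        by (auto simp: N_def dest: spec[of _ 0])
    qed
    then show ?thesis
      by (intro state_eqI) (simp_all add: inner_basis)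
  qed
  show ?thesis
  proof (rule local_reach[where F = F and A = A and B = B, OF lip zero_less_one])
    show "F (u, - u) m = 0" by (rule tension_equilibrium_field[OF eq])
    show "\<xi> = 0" if "\<And>k \<beta>. \<xi> \<bullet> (A ^^ k) (B \<beta>) = 0" for \<xi>
      using that by (rule kalman)
  qed (fact der A B)+
qed

section \<open>Time reversal and exact reachability\<close>

definition reverse :: "'n state \<Rightarrow> 'n state" where
  "reverse x = (fst x, - snd x)"

lemma reverse_reverse [simp]: "reverse (reverse x) = x"
  by (simp add: reverse_def)

lemma bounded_linear_reverse: "bounded_linear reverse"
  unfolding reverse_def
  by (rule bounded_linear_Pair[OF bounded_linear_fst bounded_linear_minus[OF bounded_linear_snd]])

lemma dist_reverse: "dist (reverse x) (reverse y) = dist x y"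
  by (simp add: reverse_def dist_prod_def dist_minus)

text \<open>Velocities are odd in the momenta while forces do not depend on them, so the same
  control value drives the reversed motion.\<close>

lemma double_forced_reverse: "F c (reverse x) = - reverse (F c x)"
proof (rule state_eqI)
  fix k assume k: "k \<in> {1..CARD('n)}"
  have q: "q_coord (reverse y) j = q_coord y j" and p: "p_coord (reverse y) j = - p_coord y j"
    and q': "q_coord (- y) j = - q_coord y j" and p': "p_coord (- y) j = - p_coord y j"
    for y :: "'n state" and j
    by (simp_all add: reverse_def q_coord_def p_coord_def)
  show "q_coord (F c (reverse x)) k = q_coord (- reverse (F c x)) k"
    unfolding q' q q_coord_double_forced[OF two_le_n k] p ..
  show "p_coord (F c (reverse x)) k = p_coord (- reverse (F c x)) k"
    unfolding p' p p_coord_double_forced[OF two_le_n k] q by simp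
qed

lemma reach_reverse:
  assumes "reach F x y"
  shows "reach F (reverse y) (reverse x)"
  using assms unfolding reach_def
proof (induction rule: rtranclp_induct)
  case (step y z)
  then obtain c t where ct: "0 \<le> t" "flow_maps (F c) t y z" by blast
  then obtain \<gamma> where \<gamma>: "\<gamma> 0 = y" "\<gamma> t = z"
    "\<And>s. s \<in> {0..t} \<Longrightarrow> (\<gamma> has_vector_derivative F c (\<gamma> s)) (at s within {0..t})"
    unfolding flow_maps_def by blast
  have "flow_maps (F c) t (reverse z) (reverse y)"
    unfolding flow_maps_def
  proof (intro exI[of _ "\<lambda>s. reverse (\<gamma> (t - s))"] conjI ballI)
    fix s assume "s \<in> {0..t}"
    then have "((\<lambda>s. \<gamma> (t - s)) has_vector_derivative - F c (\<gamma> (t - s))) (at s within {0..t})"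
      by (intro has_vector_derivative_reverse \<gamma>(3)) auto
    from bounded_linear.has_vector_derivative[OF bounded_linear_reverse this]
    show "((\<lambda>s. reverse (\<gamma> (t - s))) has_vector_derivative F c (reverse (\<gamma> (t - s)))) (at s within {0..t})"
      by (simp add: double_forced_reverse linear_neg[OF bounded_linear.linear[OF bounded_linear_reverse]])
  qed (use \<gamma> in auto)
  with ct(1) have "\<exists>c t. 0 \<le> t \<and> flow_maps (F c) t (reverse z) (reverse y)" by blast
  then show ?case
    using step.IH by (rule converse_rtranclp_into_rtranclp)
qed simp

lemma reach_common_rest_state:
  "\<exists>m \<delta>. snd m = 0 \<and> \<delta> > 0 \<and> (\<forall>y. dist y x < \<delta> \<longrightarrow> reach F y m)"
proof -
  obtain \<alpha> where \<alpha>: "\<And>u m k. tension_equilibrium u m \<Longrightarrow> \<alpha> - q_coord m 1 = u \<Longrightarrow> q_coord m CARD('n) = u \<Longrightarrow>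
    k \<in> {1..<CARD('n)} \<Longrightarrow> \<psi> (q_coord m k - q_coord m (k + 1)) \<noteq> 0"
    using exists_regular_parameter by blast
  obtain u m where m: "approx_reach F x m" "tension_equilibrium u m"
    "\<alpha> - q_coord m 1 = u" "q_coord m CARD('n) - 0 = u"
    by (rule reach_tension_equilibrium)
  have "snd m = 0" using m(2) by (simp add: tension_equilibrium_def)
  then have rev_m: "reverse m = m" by (simp add: reverse_def prod_eq_iff)
  obtain r where r: "r > 0" "\<And>y. y \<in> ball m r \<Longrightarrow> reach F m y"
    using regular_equilibrium_local_reach[OF m(2)] \<alpha>[OF m(2,3)] m(4) by auto
  \<comment> \<open>\<open>m\<close> is its own reversal, so the ball reachable from
    \<open>m\<close> is also a ball from which \<open>m\<close> is reachable.\<close>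
  have to_m: "reach F y m" if "dist y m < r" for y
  proof -
    have "reach F m (reverse y)"
      using that dist_reverse[of m y] by (intro r(2)) (simp add: rev_m dist_commute)
    from reach_reverse[OF this] show ?thesis by (simp add: rev_m)
  qed
  \<comment> \<open>The uniformity built into \<open>approx_reach\<close> sends every state near
    \<open>x\<close> into the ball around \<open>m\<close>.\<close>
  obtain \<delta> where \<delta>: "\<delta> > 0" "\<And>y. dist y x < \<delta> \<Longrightarrow> \<exists>y'. dist y' m < r \<and> reach F y y'"
    using m(1) r(1) unfolding approx_reach_def by blast
  show ?thesis
    using \<open>snd m = 0\<close> \<delta> to_m reach_trans by blast
qed

lemma reach_rest_states: "reach F (q, 0) (q', 0 :: (real, 'n) vec)"
proof (rule connected_equivalence_relation[of "UNIV :: (real, 'n) vec set" q q' "\<lambda>q q'. reach F (q, 0) (q', 0)"])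
  have sym: "reach F (b, 0) (a, 0)" if "reach F (a, 0) (b, 0)" for a b :: "(real, 'n) vec"
    using reach_reverse[OF that] by (simp add: reverse_def)
  then show "reach F (b, 0) (a, 0)" if "reach F (a, 0) (b, 0)" for a b :: "(real, 'n) vec"
    using that .
  show "reach F (a, 0) (c, 0)" if "reach F (a, 0) (b, 0)" "reach F (b, 0) (c, 0)" for a b c :: "(real, 'n) vec"
    using that by (rule reach_trans)
  show "\<exists>T. openin (top_of_set UNIV) T \<and> a \<in> T \<and> (\<forall>b\<in>T. reach F (a, 0) (b, 0))" for a :: "(real, 'n) vec"
  proof -
    obtain m \<delta> where m: "snd m = 0" "\<delta> > 0" "\<And>y. dist y (a, 0) < \<delta> \<Longrightarrow> reach F y m"
      using reach_common_rest_state[of "(a, 0)"] by blast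
    have *: "reach F (b, 0) (fst m, 0)" if "b \<in> ball a \<delta>" for b
      using m(3)[of "(b, 0)"] m(1) that by (simp add: dist_Pair_Pair dist_commute) (metis prod.collapse)
    show ?thesis
    proof (intro exI[of _ "ball a \<delta>"] conjI ballI)
      show "reach F (a, 0) (b, 0)" if "b \<in> ball a \<delta>" for b
        \<comment> \<open>Both states reach the rest state \<open>m\<close>; the path from
          \<open>(b, 0)\<close> is turned around.\<close>
        by (rule reach_trans[OF *[of a] sym[OF *[OF that]]]) (use m(2) in simp)
    qed (use m(2) in auto)
  qed
qed auto

lemma reach_all: "reach F x y"
proof -
  obtain m \<delta> where m: "snd m = 0" "\<delta> > 0" "\<And>z. dist z x < \<delta> \<Longrightarrow> reach F z m"
    using reach_common_rest_state by blast
  \<comment> \<open>Reversing a path from \<open>reverse y\<close> to a rest state gives a path from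
    that rest state to \<open>y\<close>.\<close>
  obtain m' \<delta>' where m': "snd m' = 0" "\<delta>' > 0" "\<And>z. dist z (reverse y) < \<delta>' \<Longrightarrow> reach F z m'"
    using reach_common_rest_state by blast
  have "reach F x m" using m by simp
  moreover have "reach F m m'"
    using reach_rest_states[of "fst m" "fst m'"] m(1) m'(1) by (metis prod.collapse)
  moreover have "reach F m' y"
  proof -
    have "reverse m' = m'" using m'(1) by (simp add: reverse_def prod_eq_iff)
    then show ?thesis
      using reach_reverse[OF m'(3)[of "reverse y"]] m'(2) by simp
  qed
  ultimately show ?thesis
    using reach_trans by blast
qed

end

theorem theorem3p2:
  fixes \<Phi> \<phi> :: "real \<Rightarrow> real"
  assumes "CARD('n::{finite,linorder}) \<ge> 2"
    and "real_analytic \<Phi>"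
    and "bdd_below (range \<Phi>)"
    and "filterlim \<Phi> at_top at_top"
    and "\<And>y. (\<Phi> has_real_derivative \<phi> y) (at y)"
  shows "globally_controllable
           (double_forced \<phi> :: real \<times> real \<Rightarrow> 'n state \<Rightarrow> 'n state)"
proof -
  have an_\<phi>: "real_analytic \<phi>"
    by (rule real_analytic_deriv[OF assms(2,5)])
  obtain \<psi> where \<psi>: "\<And>y. (\<phi> has_real_derivative \<psi> y) (at y)"
    using real_analytic_has_derivative[OF an_\<phi>] by blast
  have an_\<psi>: "real_analytic \<psi>"
    by (rule real_analytic_deriv[OF an_\<phi> \<psi>])
  obtain \<psi>' where \<psi>': "\<And>y. (\<psi> has_real_derivative \<psi>' y) (at y)"
    using real_analytic_has_derivative[OF an_\<psi>] by blast
  have nonconst: "\<exists>y. \<phi> y \<noteq> u" for u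
    by (rule deriv_nonconstant[OF assms(3-5)])
  have "\<exists>y. \<psi> y \<noteq> 0"
  proof (rule ccontr)
    assume "\<not> ?thesis"
    then have "(\<phi> has_real_derivative 0) (at y)" for y using \<psi>[of y] by simp
    then have "\<phi> y = \<phi> 0" for y using DERIV_isconst_all[of \<phi> y 0] by blast
    then show False using nonconst by blast
  qed
  interpret chain \<Phi> \<phi> \<psi> "TYPE('n)"
  proof
    show "continuous_on UNIV \<psi>"
      by (intro continuous_at_imp_continuous_on ballI DERIV_isCont[OF \<psi>'])
    show "countable {y. \<phi> y = u}" for u
      using real_analytic_countable_zeros[OF real_analytic_diff_const[OF an_\<phi>, of u]] nonconst[of u] by simp
    show "countable {y. \<psi> y = 0}"
      by (rule real_analytic_countable_zeros[OF an_\<psi>]) fact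
  qed (fact assms \<psi>)+
  show ?thesis
    unfolding globally_controllable_def using reach_imp_attainable[OF reach_all] by auto
qed

end
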